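(* Consider the branching process with immediate offspring distribution $\{p_j\}_{j\ge0}$ such that $p_0>0$, $p_1=0$ and $\sum_{j\ge0}jp_j=1$. With probability $1$ the process eventually stops, so that a finite terminal tree $T_t$ is almost surely well-defined. (1) Let $A_n=\{T_t\text{ has }n\text{ leaves}\}$ and $P(\eta):=\sum_{j\ge0}p_j\eta^j$. Then $$\mathbb P(A_n)=[y^n]\,\Phi(y),\qquad\text{where } \Phi(y)=P(\Phi(y))+p_0(y-1).$$ (2) On the event $A_n$, let $T_n$ be the tree $T_t$ with leaves labelled uniformly at random by the elements of $[n]$. Given a rooted tree $\mathcal T$ with leaf-set $S\subset[n]$, $a:=|S|$, let $A_n(\mathcal T)$ be the event that $A_n$ holds and $S$ induces $\mathcal T$ in $T_n$. Then $\mathbb P(A_n(\mathcal T)\mid A_n)=\mathbb P(A_n(\mathcal T))/\mathbb P(A_n)$, where $$\mathbb P(A_n(\mathcal T))=\frac{\mathbb P(\mathcal T)\,(n-a)!}{p_0\,n!}\,[y^{n-a}]\,(1-\Phi_1(y))^{-e(\mathcal T)}\,\Phi'(y),$$ $$\Phi_1(y)=\sum_{j>1}jp_j\,\Phi^{j-1}(y),\qquad \mathbb P(\mathcal T)=\prod_{v\in V(\mathcal T)}p_{d(v,\mathcal T)},$$ and $V(\mathcal T)$, $e(\mathcal T)$ and $d(v,\mathcal T)$ are, respectively, the vertex set of $\mathcal T$, the number of edges of $\mathcal T$, and the out-degree (number of children) of $v$ in $\mathcal T$.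
   Context: $[n]=\{1,\dots,n\}$; $[y^n]f(y)$ is the coefficient of $y^n$ in the power series $f$. $\Phi$ is the power series with zero constant term satisfying the stated functional equation; it is the probability generating function of the number of leaves of $T_t$. The branching (Galton--Watson) process starts from a single progenitor (the root); each individual independently has $j$ children with probability $p_j$, and the children of each individual are ordered. The terminal tree $T_t$ is the rooted tree with ordered children that the process has produced when it stops. A leaf is a vertex with out-degree zero. Trees $\mathcal T$ are rooted, with ordered children and with leaves labelled bijectively by a nonempty set $S\subset[n]$, every non-leaf vertex having at least two children; leaf-labelled trees are regarded up to isomorphism preserving root, order of children and leaf labels. The LCA subtree of $S$ in $T_n$ is the subtree formed by the paths from the lowest common ancestor $v(S)$ of the leaves in $S$ to these leaves, rooted at $v(S)$, with inherited order of children. $S$ induces $\mathcal T$ in $T_n$ if (a) the LCA subtree for $S$ in $T_n$ becomes $\mathcal T$ after suppressing its vertices, other than the root, that have total degree 2 in this LCA subtree; and (b) the out-degree in $T_n$ of every other (non-suppressed) vertex of the LCA subtree is the same as its out-degree in $\mathcal T$. *)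

theory Defs
  imports "HOL-Probability.Probability" "HOL-Library.Sublist"
    "HOL-Computational_Algebra.Formal_Power_Series"
begin

section \<open>Ordered rooted trees as sets of addresses\<close>

text \<open>
  A vertex is the list of child positions (counted from 0) on the path from the root to it.
  Finite prefix-closed sets without gaps among siblings are in bijection with the isomorphism
  classes of finite rooted trees with ordered children.

  The notions below also apply to subsets W of such a tree (e.g. the LCA subtree, before and after
  suppressing vertices): ancestry is the prefix order, so a child of u in W is a minimal proper
  descendant of u in W, and siblings are ordered from left to right by \<^term>\<open>lexord less_than\<close>.
\<close>

definition plane_tree :: "nat list set \<Rightarrow> bool" where
  "plane_tree t \<longleftrightarrow> finite t \<and> [] \<in> t \<and>
     (\<forall>u i. u @ [i] \<in> t \<longrightarrow> u \<in> t \<and> (\<forall>j<i. u @ [j] \<in> t))"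

definition children :: "nat list set \<Rightarrow> nat list \<Rightarrow> nat list set" where
  "children W u =
     {w \<in> W. strict_prefix u w \<and> \<not> (\<exists>z\<in>W. strict_prefix u z \<and> strict_prefix z w)}"

definition outdeg :: "nat list set \<Rightarrow> nat list \<Rightarrow> nat" where
  "outdeg W u = card (children W u)"

definition total_degree :: "nat list set \<Rightarrow> nat list \<Rightarrow> nat" where
  "total_degree W u = outdeg W u + card {z \<in> W. u \<in> children W z}"

definition leaves :: "nat list set \<Rightarrow> nat list set" where
  "leaves W = {u \<in> W. children W u = {}}"

definition tree_edges :: "nat list set \<Rightarrow> (nat list \<times> nat list) set" where
  "tree_edges W = {(u, w). u \<in> W \<and> w \<in> children W u}"

definition leaf_labelled_tree :: "nat list set \<Rightarrow> (nat list \<Rightarrow> nat) \<Rightarrow> nat set \<Rightarrow> bool" where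
  "leaf_labelled_tree \<tau> lab S \<longleftrightarrow>
     plane_tree \<tau> \<and> bij_betw lab (leaves \<tau>) S \<and> (\<forall>u \<in> \<tau> - leaves \<tau>. outdeg \<tau> u \<ge> 2)"

definition labelled_tree_iso ::
  "(nat list \<Rightarrow> nat list) \<Rightarrow> nat list \<Rightarrow> nat list set \<Rightarrow> (nat list \<Rightarrow> nat)
     \<Rightarrow> nat list \<Rightarrow> nat list set \<Rightarrow> (nat list \<Rightarrow> nat) \<Rightarrow> bool" where
  "labelled_tree_iso \<phi> r W lab r' W' lab' \<longleftrightarrow>
     bij_betw \<phi> W W' \<and> \<phi> r = r' \<and>
     (\<forall>u\<in>W. \<forall>w\<in>W. w \<in> children W u \<longleftrightarrow> \<phi> w \<in> children W' (\<phi> u)) \<and>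
     (\<forall>u\<in>W. \<forall>w\<in>children W u. \<forall>z\<in>children W u.
        (w, z) \<in> lexord less_than \<longrightarrow> (\<phi> w, \<phi> z) \<in> lexord less_than) \<and>
     (\<forall>u\<in>leaves W. lab' (\<phi> u) = lab u)"


section \<open>Induced leaf-labelled trees\<close>

text \<open>Below, L labels the leaves of t; its values elsewhere are irrelevant.\<close>

definition labelled_leaves :: "nat list set \<Rightarrow> (nat list \<Rightarrow> nat) \<Rightarrow> nat set \<Rightarrow> nat list set" where
  "labelled_leaves t L S = {u \<in> leaves t. L u \<in> S}"

definition lca :: "nat list set \<Rightarrow> (nat list \<Rightarrow> nat) \<Rightarrow> nat set \<Rightarrow> nat list" where
  "lca t L S = Longest_common_prefix (labelled_leaves t L S)"

definition lca_subtree :: "nat list set \<Rightarrow> (nat list \<Rightarrow> nat) \<Rightarrow> nat set \<Rightarrow> nat list set" where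
  "lca_subtree t L S = {u \<in> t. prefix (lca t L S) u \<and> (\<exists>s\<in>labelled_leaves t L S. prefix u s)}"

definition suppress :: "nat list \<Rightarrow> nat list set \<Rightarrow> nat list set" where
  "suppress r W = W - {u \<in> W. u \<noteq> r \<and> total_degree W u = 2}"

definition induces ::
  "nat list set \<Rightarrow> (nat list \<Rightarrow> nat) \<Rightarrow> nat set \<Rightarrow> nat list set \<Rightarrow> (nat list \<Rightarrow> nat) \<Rightarrow> bool" where
  "induces t L S \<tau> lab \<longleftrightarrow>
     (\<exists>\<phi>. labelled_tree_iso \<phi> [] \<tau> lab
             (lca t L S) (suppress (lca t L S) (lca_subtree t L S)) L \<and>
          (\<forall>u\<in>\<tau>. outdeg t (\<phi> u) = outdeg \<tau> u))"


section \<open>The branching process\<close>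

text \<open>The family tree when each potential individual u has \<open>\<xi> u\<close> children.\<close>

inductive_set family_tree :: "(nat list \<Rightarrow> nat) \<Rightarrow> nat list set" for \<xi> where
  root: "[] \<in> family_tree \<xi>"
| child: "u \<in> family_tree \<xi> \<Longrightarrow> i < \<xi> u \<Longrightarrow> u @ [i] \<in> family_tree \<xi>"

definition generation :: "(nat list \<Rightarrow> nat) \<Rightarrow> nat \<Rightarrow> nat list set" where
  "generation \<xi> k = {u \<in> family_tree \<xi>. length u = k}"

definition stops :: "(nat list \<Rightarrow> nat) \<Rightarrow> bool" where
  "stops \<xi> \<longleftrightarrow> (\<exists>k. generation \<xi> k = {})"

definition branching_process :: "'w measure \<Rightarrow> nat pmf \<Rightarrow> (nat list \<Rightarrow> 'w \<Rightarrow> nat) \<Rightarrow> bool" where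
  "branching_process M p X \<longleftrightarrow>
     prob_space M \<and>
     prob_space.indep_vars M (\<lambda>_. count_space UNIV) X UNIV \<and>
     (\<forall>u. distr M (count_space UNIV) (X u) = measure_pmf p)"

definition terminal_tree :: "(nat list \<Rightarrow> 'w \<Rightarrow> nat) \<Rightarrow> 'w \<Rightarrow> nat list set" where
  "terminal_tree X \<omega> = family_tree (\<lambda>u. X u \<omega>)"

definition has_leaves :: "(nat list \<Rightarrow> 'w \<Rightarrow> nat) \<Rightarrow> nat \<Rightarrow> 'w \<Rightarrow> bool" where
  "has_leaves X n \<omega> \<longleftrightarrow> stops (\<lambda>u. X u \<omega>) \<and> card (leaves (terminal_tree X \<omega>)) = n"

text \<open>
  Given that the terminal tree is t, with n leaves, the labelling of the leaves of t by L is uniform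
  among the bijections onto \<open>{1..n}\<close>. As n is determined by t, one L serves for all n.
\<close>

definition uniform_leaf_labelling ::
  "'w measure \<Rightarrow> (nat list \<Rightarrow> 'w \<Rightarrow> nat) \<Rightarrow> (nat list \<Rightarrow> 'w \<Rightarrow> nat) \<Rightarrow> bool" where
  "uniform_leaf_labelling M X L \<longleftrightarrow>
     (\<forall>u. L u \<in> measurable M (count_space UNIV)) \<and>
     (\<forall>t f. plane_tree t \<and> bij_betw f (leaves t) {1..card (leaves t)} \<and>
        \<P>(\<omega> in M. terminal_tree X \<omega> = t) > 0 \<longrightarrow>
        \<P>(\<omega> in M. (\<forall>u\<in>leaves t. L u \<omega> = f u) \<bar> terminal_tree X \<omega> = t)
          = 1 / fact (card (leaves t)))"

definition induced_event ::
  "(nat list \<Rightarrow> 'w \<Rightarrow> nat) \<Rightarrow> (nat list \<Rightarrow> 'w \<Rightarrow> nat) \<Rightarrow> nat \<Rightarrow> nat set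
     \<Rightarrow> nat list set \<Rightarrow> (nat list \<Rightarrow> nat) \<Rightarrow> 'w \<Rightarrow> bool" where
  "induced_event X L n S \<tau> lab \<omega> \<longleftrightarrow>
     has_leaves X n \<omega> \<and> induces (terminal_tree X \<omega>) (\<lambda>u. L u \<omega>) S \<tau> lab"


section \<open>Generating functions\<close>

definition offspring_fps :: "nat pmf \<Rightarrow> real fps" where
  "offspring_fps p = Abs_fps (pmf p)"

definition leaf_gf :: "nat pmf \<Rightarrow> real fps \<Rightarrow> bool" where
  "leaf_gf p \<Phi> \<longleftrightarrow> fps_nth \<Phi> 0 = 0 \<and>
     \<Phi> = fps_compose (offspring_fps p) \<Phi> + fps_const (pmf p 0) * (fps_X - 1)"

text \<open>The series \<open>\<Sum>j>1. j p\<^sub>j \<Phi>^(j-1)\<close>, as the composition of \<open>\<Sum>k\<ge>1. (k+1) p\<^sub>k\<^sub>+\<^sub>1 y^k\<close> with \<open>\<Phi>\<close>.\<close>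

definition Phi1 :: "nat pmf \<Rightarrow> real fps \<Rightarrow> real fps" where
  "Phi1 p \<Phi> =
     fps_compose (Abs_fps (\<lambda>k. if k \<ge> 1 then real (k + 1) * pmf p (k + 1) else 0)) \<Phi>"

definition tree_prob :: "nat pmf \<Rightarrow> nat list set \<Rightarrow> real" where
  "tree_prob p \<tau> = (\<Prod>v\<in>\<tau>. pmf p (outdeg \<tau> v))"

end

theory Submission
  imports Defs
begin

text \<open>
  The formula comes from counting the positions of \<open>\<tau>\<close> inside the terminal tree. A labelling of a tree
  \<open>t\<close> with \<open>n\<close> leaves induces \<open>\<tau>\<close> if and only if there is a map \<open>\<phi>\<close> from the vertices of \<open>\<tau>\<close> to those of
  \<open>t\<close> that preserves out-degrees, places the \<open>i\<close>-th child of each \<open>u\<close> at or below the \<open>i\<close>-th child of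
  \<open>\<phi> u\<close>, and carries leaves to leaves with the same label (\<open>induces_iff_strong_embedding\<close>). The
  suppressed vertices are those strictly between \<open>\<phi> u\<close> and the image of a child of \<open>u\<close>. The labelling
  determines \<open>\<phi>\<close>, and \<open>\<phi>\<close> fixes \<open>a\<close> of the \<open>n\<close> labels while the other \<open>n - a\<close> are free. Hence
  a uniform labelling of \<open>t\<close> induces \<open>\<tau>\<close> with probability \<open>N(\<tau>, t) (n - a)! / n!\<close>, where \<open>N(\<tau>, t)\<close> is
  the number of these maps, called strong embeddings below (\<open>card_inducing_labellings\<close>), and
  everything reduces to the coefficients of the series \<open>G\<^sub>\<tau>(y)\<close> that sums
  \<open>\<P>(t) N(\<tau>, t) y^(number of leaves of t)\<close> over all finite trees \<open>t\<close>.

  Cut \<open>t\<close> at its root. A strong embedding of \<open>\<tau>\<close> either maps root to root, and then it is a free choice of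
  a strong embedding of each branch of \<open>\<tau>\<close> into the corresponding branch of \<open>t\<close>; or it goes entirely
  into one branch of \<open>t\<close> (\<open>card_strong_embeddings_graft\<close>). If the root of \<open>t\<close> has \<open>j\<close> children, the
  second case contributes \<open>j p\<^sub>j \<Phi>^(j-1) G\<^sub>\<tau>\<close>; summed over \<open>j\<close> this is \<open>\<Phi>\<^sub>1 G\<^sub>\<tau>\<close>. So
  \<open>(1 - \<Phi>\<^sub>1) G\<^sub>\<tau>\<close> is \<open>p\<^sub>k\<close> times the product of the series of the \<open>k\<close> branches of \<open>\<tau>\<close>, or \<open>p\<^sub>0 y\<close> if \<open>\<tau>\<close> is
  a single vertex, and induction on \<open>\<tau>\<close> gives \<open>(1 - \<Phi>\<^sub>1)^|V(\<tau>)| G\<^sub>\<tau> = \<P>(\<tau>) y^a\<close>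
  (\<open>embedding_gf_closed\<close>). Since \<open>|V(\<tau>)| = e(\<tau>) + 1\<close>, there is one factor \<open>(1 - \<Phi>\<^sub>1)^(-1)\<close> besides
  \<open>(1 - \<Phi>\<^sub>1)^(-e(\<tau>))\<close>. Differentiating the functional equation of \<open>\<Phi>\<close> yields
  \<open>(1 - \<Phi>\<^sub>1) \<Phi>' = p\<^sub>0\<close>, so this factor is \<open>\<Phi>' / p\<^sub>0\<close> (\<open>embedding_gf_nth\<close>).

  As \<open>p\<^sub>1 = 0\<close>, trees with a vertex of out-degree 1 have probability 0, and only finitely many trees
  without such vertices have \<open>n\<close> leaves. All coefficients are therefore finite sums, and the
  decomposition at the root, applied to \<open>\<Phi>\<close> itself, is the functional equation.

  Almost sure extinction also follows from \<open>\<Phi>\<close>. The value \<open>s = \<Phi>(1) \<le> 1\<close>, the total probability of the finite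
  trees, satisfies \<open>P(s) \<le> s\<close>. With mean one, \<open>P(s) - s\<close> is the sum of the terms
  \<open>p\<^sub>j (s^j - 1 + j (1 - s))\<close>, which are nonnegative by Bernoulli's inequality and strictly positive when
  \<open>s < 1\<close>, \<open>j \<ge> 2\<close> and \<open>p\<^sub>j > 0\<close>. Such a \<open>j\<close> exists because the mean is one and \<open>p\<^sub>1 = 0\<close>, so \<open>s = 1\<close>
  (\<open>leaf_gf_sums_1\<close>).
\<close>

section \<open>Vertices and children in plane trees\<close>

text \<open>
  Both plane trees and LCA subtrees are closed under passing to intermediate vertices. This is what makes
  the children in the order-theoretic sense the same as the one-step extensions in the set.
\<close>

definition convex_nodes :: "nat list set \<Rightarrow> bool" where
  "convex_nodes W \<longleftrightarrow> (\<forall>u\<in>W. \<forall>w\<in>W. \<forall>z. prefix u z \<and> prefix z w \<longrightarrow> z \<in> W)"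

lemma convex_nodesD:
  "convex_nodes W \<Longrightarrow> u \<in> W \<Longrightarrow> w \<in> W \<Longrightarrow> prefix u z \<Longrightarrow> prefix z w \<Longrightarrow> z \<in> W"
  unfolding convex_nodes_def by blast

lemma children_convex:
  assumes "convex_nodes W" "u \<in> W"
  shows "children W u = {u @ [i] | i. u @ [i] \<in> W}"
proof (intro equalityI subsetI)
  fix w assume w: "w \<in> children W u"
  then obtain v' where "w = u @ v'" "v' \<noteq> []"
    by (auto simp: children_def strict_prefix_def prefix_def)
  then obtain i v where v: "w = u @ i # v" by (metis neq_Nil_conv)
  have "u @ [i] \<in> W" using assms w v unfolding convex_nodes_def children_def
    by (metis (no_types, lifting) append.assoc append_Cons append_Nil mem_Collect_eq prefixI)
  with w v have "v = []"
    unfolding children_def by (auto simp: strict_prefix_def prefix_def)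
  with v \<open>u @ [i] \<in> W\<close> show "w \<in> {u @ [i] | i. u @ [i] \<in> W}" by auto
next
  fix w assume "w \<in> {u @ [i] | i. u @ [i] \<in> W}"
  then show "w \<in> children W u"
    unfolding children_def by (auto simp: strict_prefix_def prefix_snoc)
qed

lemma plane_tree_finite: "plane_tree t \<Longrightarrow> finite t"
  and plane_tree_root: "plane_tree t \<Longrightarrow> [] \<in> t"
  by (simp_all add: plane_tree_def)

lemma plane_tree_parent: "plane_tree t \<Longrightarrow> u @ [i] \<in> t \<Longrightarrow> u \<in> t"
  and plane_tree_sibling: "plane_tree t \<Longrightarrow> u @ [i] \<in> t \<Longrightarrow> j < i \<Longrightarrow> u @ [j] \<in> t"
  unfolding plane_tree_def by blast+

lemma plane_tree_prefix_closed:
  assumes "plane_tree t" "w \<in> t" "prefix u w"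
  shows "u \<in> t"
proof -
  have "u @ v \<in> t \<Longrightarrow> u \<in> t" for v
  proof (induction v rule: rev_induct)
    case (snoc i v)
    then show ?case using plane_tree_parent[OF assms(1), of "u @ v" i] by simp
  qed simp
  with assms show ?thesis by (auto simp: prefix_def)
qed

lemma convex_plane_tree: "plane_tree t \<Longrightarrow> convex_nodes t"
  unfolding convex_nodes_def using plane_tree_prefix_closed by blast

lemma children_plane_tree:
  "plane_tree t \<Longrightarrow> u \<in> t \<Longrightarrow> children t u = {u @ [i] | i. u @ [i] \<in> t}"
  by (rule children_convex[OF convex_plane_tree])

text \<open>
  Siblings have no gaps, so the positions of the children form an initial segment of the naturals.
\<close>

lemma child_iff_less_outdeg:
  assumes "plane_tree t" "u \<in> t"
  shows "u @ [i] \<in> t \<longleftrightarrow> i < outdeg t u"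
proof -
  define I where "I = {i. u @ [i] \<in> t}"
  have ch: "children t u = (\<lambda>i. u @ [i]) ` I"
    using children_plane_tree[OF assms] by (auto simp: I_def)
  have down: "j \<in> I" if "i \<in> I" "j \<le> i" for i j
    using that plane_tree_sibling[OF assms(1)] unfolding I_def by (cases "j = i") auto
  have "finite ((\<lambda>i. u @ [i]) ` I)"
    by (rule finite_subset[of _ t]) (use plane_tree_finite[OF assms(1)] in \<open>auto simp: I_def\<close>)
  then have fin: "finite I" by (rule finite_imageD) (simp add: inj_on_def)
  have card: "outdeg t u = card I"
    unfolding outdeg_def ch by (rule card_image) (simp add: inj_on_def)
  have "I = {..<card I}"
  proof (cases "I = {}")
    case False
    then have "I = {..Max I}" using down fin by (auto intro: Max_ge Max_in)
    then show ?thesis by (metis card_atMost lessThan_Suc_atMost)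
  qed simp
  then show ?thesis using card by (auto simp: I_def)
qed

lemma outdeg_eqI:
  assumes "plane_tree t" "u \<in> t" "\<And>i. u @ [i] \<in> t \<longleftrightarrow> i < k"
  shows "outdeg t u = k"
  using child_iff_less_outdeg[OF assms(1,2)] assms(3)
  by (metis linorder_neqE_nat less_irrefl)

lemma leaf_iff_outdeg:
  assumes "plane_tree t"
  shows "leaves t = {u \<in> t. outdeg t u = 0}"
proof -
  have "finite (children t u)" for u
    by (rule finite_subset[of _ t]) (use plane_tree_finite[OF assms] in \<open>auto simp: children_def\<close>)
  then show ?thesis unfolding leaves_def outdeg_def by auto
qed

section \<open>Terminal trees as plane trees\<close>

lemma family_tree_snoc: "u @ [i] \<in> family_tree \<xi> \<longleftrightarrow> u \<in> family_tree \<xi> \<and> i < \<xi> u"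
  by (auto intro: family_tree.child elim: family_tree.cases)

text \<open>
  Each generation is finite, since every individual has finitely many children. The process therefore
  stops if and only if the family tree is finite.
\<close>

lemma stops_iff_plane_tree: "stops \<xi> \<longleftrightarrow> plane_tree (family_tree \<xi>)"
proof
  assume "stops \<xi>"
  then obtain k where k: "generation \<xi> k = {}" unfolding stops_def by auto
  have gen_Suc: "generation \<xi> (Suc m) = (\<Union>u\<in>generation \<xi> m. (\<lambda>i. u @ [i]) ` {..<\<xi> u})" for m
  proof (intro equalityI subsetI)
    fix w assume w: "w \<in> generation \<xi> (Suc m)"
    then obtain v i where "w = v @ [i]" by (auto simp: generation_def length_Suc_conv_rev)
    with w show "w \<in> (\<Union>u\<in>generation \<xi> m. (\<lambda>i. u @ [i]) ` {..<\<xi> u})"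
      by (auto simp: generation_def family_tree_snoc)
  qed (auto simp: generation_def family_tree_snoc)
  have fin: "finite (generation \<xi> m)" for m
  proof (induction m)
    case 0
    have "generation \<xi> 0 \<subseteq> {[]}" by (auto simp: generation_def)
    then show ?case using finite_subset by blast
  qed (simp add: gen_Suc)
  have "generation \<xi> (k + d) = {}" for d
    by (induction d) (simp_all add: k gen_Suc)
  then have "length u < k" if "u \<in> family_tree \<xi>" for u
    using that by (auto simp: generation_def) (metis le_Suc_ex not_le)
  then have "family_tree \<xi> \<subseteq> (\<Union>m<k. generation \<xi> m)" by (auto simp: generation_def)
  then have "finite (family_tree \<xi>)" using fin finite_subset by blast
  then show "plane_tree (family_tree \<xi>)"
    unfolding plane_tree_def family_tree_snoc by (auto intro: family_tree.root)
next
  assume "plane_tree (family_tree \<xi>)"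
  then have "finite (length ` family_tree \<xi>)" by (simp add: plane_tree_def)
  then obtain k where "\<forall>m\<in>length ` family_tree \<xi>. m < k"
    using finite_nat_set_iff_bounded by blast
  then have "generation \<xi> k = {}" by (auto simp: generation_def)
  then show "stops \<xi>" by (auto simp: stops_def)
qed

text \<open>
  The event that the family tree is \<open>t\<close> thus involves only the offspring numbers of the vertices of \<open>t\<close>,
  which makes it a finite intersection of independent events.
\<close>

lemma family_tree_eq_iff:
  assumes "plane_tree t"
  shows "family_tree \<xi> = t \<longleftrightarrow> (\<forall>u\<in>t. \<xi> u = outdeg t u)"
proof
  assume eq: "family_tree \<xi> = t"
  show "\<forall>u\<in>t. \<xi> u = outdeg t u"
    using outdeg_eqI[OF assms] family_tree_snoc[of _ _ \<xi>] unfolding eq by metis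
next
  assume *: "\<forall>u\<in>t. \<xi> u = outdeg t u"
  have "u \<in> family_tree \<xi> \<longleftrightarrow> u \<in> t" for u
  proof (induction u rule: rev_induct)
    case Nil
    then show ?case using plane_tree_root[OF assms] by (simp add: family_tree.root)
  next
    case (snoc i u)
    show ?case
    proof (cases "u \<in> t")
      case True
      then show ?thesis
        using snoc * child_iff_less_outdeg[OF assms True] by (simp add: family_tree_snoc)
    next
      case False
      then have "u @ [i] \<notin> t" using plane_tree_parent[OF assms] by blast
      then show ?thesis using snoc False by (simp add: family_tree_snoc)
    qed
  qed
  then show "family_tree \<xi> = t" by blast
qed

section \<open>Decomposition of a plane tree at its root\<close>

text \<open>
  The tree whose root has the given trees as branches, in this order.
\<close>

definition graft :: "nat list set list \<Rightarrow> nat list set" where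
  "graft ts = insert [] (\<Union>i<length ts. Cons i ` (ts ! i))"

lemma Nil_in_graft [simp]: "[] \<in> graft ts"
  by (simp add: graft_def)

lemma Cons_in_graft [simp]: "i # u \<in> graft ts \<longleftrightarrow> i < length ts \<and> u \<in> ts ! i"
  by (auto simp: graft_def)

lemma plane_tree_graft:
  assumes "\<forall>s\<in>set ts. plane_tree s"
  shows "plane_tree (graft ts)"
proof -
  have pl: "plane_tree (ts ! i)" if "i < length ts" for i using assms that by simp
  have "finite (graft ts)"
    unfolding graft_def using pl plane_tree_finite by simp
  moreover have "u \<in> graft ts \<and> (\<forall>j<i. u @ [j] \<in> graft ts)" if "u @ [i] \<in> graft ts" for u i
  proof (cases u)
    case Nil
    then show ?thesis using that pl plane_tree_root by auto
  next
    case (Cons k v)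
    then show ?thesis
      using that pl[of k] plane_tree_parent[of "ts ! k" v i] plane_tree_sibling[of "ts ! k" v i] by auto
  qed
  ultimately show ?thesis unfolding plane_tree_def by simp
qed

lemma outdeg_graft_Nil:
  assumes "\<forall>s\<in>set ts. plane_tree s"
  shows "outdeg (graft ts) [] = length ts"
  by (rule outdeg_eqI[OF plane_tree_graft[OF assms]])
    (use assms plane_tree_root in auto)

lemma outdeg_graft_Cons:
  assumes "\<forall>s\<in>set ts. plane_tree s" "i < length ts" "u \<in> ts ! i"
  shows "outdeg (graft ts) (i # u) = outdeg (ts ! i) u"
  by (rule outdeg_eqI[OF plane_tree_graft[OF assms(1)]])
    (use assms in \<open>auto simp: child_iff_less_outdeg\<close>)

lemma graft_inject:
  assumes "\<forall>s\<in>set ts. plane_tree s" "\<forall>s\<in>set ts'. plane_tree s"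
    and "graft ts = graft ts'"
  shows "ts = ts'"
proof -
  have len: "length ts = length ts'"
    using outdeg_graft_Nil[of ts] outdeg_graft_Nil[of ts'] assms by simp
  moreover have "ts ! i = ts' ! i" if "i < length ts" for i
    using that len assms(3) Cons_in_graft[of i _ ts] Cons_in_graft[of i _ ts'] by auto
  ultimately show ?thesis by (simp add: nth_equalityI)
qed

lemma plane_tree_is_graft:
  assumes t: "plane_tree t"
  shows "\<exists>ts. t = graft ts \<and> (\<forall>s\<in>set ts. plane_tree s \<and> card s < card t)"
proof -
  define below where "below i = {u. i # u \<in> t}" for i
  define ts where "ts = map below [0..<outdeg t []]"
  have root: "[] \<in> t" and fin: "finite t" using t by (simp_all add: plane_tree_root plane_tree_finite)
  have child: "[i] \<in> t \<longleftrightarrow> i < outdeg t []" for i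
    using child_iff_less_outdeg[OF t root, of i] by simp
  have nonroot: "i < outdeg t []" if "i # u \<in> t" for i u
    using plane_tree_prefix_closed[OF t that, of "[i]"] child by simp
  have "u \<in> t \<longleftrightarrow> u \<in> graft ts" for u
    by (cases u) (use root nonroot in \<open>auto simp: ts_def below_def\<close>)
  then have "t = graft ts" by blast
  moreover have "plane_tree s \<and> card s < card t" if "s \<in> set ts" for s
  proof -
    have "\<exists>i<outdeg t []. s = below i"
      using \<open>s \<in> set ts\<close> by (auto simp: ts_def)
    then obtain i where i: "i < outdeg t []" "s = below i" by blast
    have inj: "inj_on (Cons i) (below i)" by simp
    have sub: "Cons i ` below i \<subset> t" using root by (auto simp: below_def)
    have "finite (below i)"
      by (rule finite_imageD[OF _ inj]) (use sub fin finite_subset in blast)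
    moreover have "card (below i) < card t"
      using psubset_card_mono[OF fin sub] card_image[OF inj] by simp
    moreover have "u \<in> below i \<and> (\<forall>k<j. u @ [k] \<in> below i)" if "u @ [j] \<in> below i" for u j
      using that plane_tree_parent[OF t, of "i # u" j] plane_tree_sibling[OF t, of "i # u" j]
      by (simp add: below_def)
    moreover have "[] \<in> below i" using i child by (simp add: below_def)
    ultimately show ?thesis unfolding i plane_tree_def by blast
  qed
  ultimately show ?thesis by blast
qed

lemma plane_tree_induct [consumes 1, case_names graft]:
  assumes "plane_tree t"
    and step: "\<And>ts. \<forall>s\<in>set ts. plane_tree s \<Longrightarrow> \<forall>s\<in>set ts. Q s \<Longrightarrow> Q (graft ts)"
  shows "Q t"
  using assms(1)
proof (induction "card t" arbitrary: t rule: less_induct)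
  case less
  obtain ts where ts: "t = graft ts" "\<forall>s\<in>set ts. plane_tree s \<and> card s < card t"
    using plane_tree_is_graft[OF less.prems] by blast
  show ?case unfolding ts(1) by (rule step) (use ts less.hyps in auto)
qed

lemma prod_graft:
  fixes f :: "nat list \<Rightarrow> 'b::comm_monoid_mult"
  assumes "\<forall>s\<in>set ts. finite s"
  shows "prod f (graft ts) = f [] * (\<Prod>i<length ts. \<Prod>u\<in>ts ! i. f (i # u))"
proof -
  have "prod f (graft ts) = f [] * prod f (\<Union>i<length ts. Cons i ` (ts ! i))"
    unfolding graft_def by (rule prod.insert) (use assms in auto)
  also have "prod f (\<Union>i<length ts. Cons i ` (ts ! i))
      = (\<Prod>i<length ts. prod f (Cons i ` (ts ! i)))"
    by (rule prod.UNION_disjoint) (use assms in auto)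
  also have "\<dots> = (\<Prod>i<length ts. \<Prod>u\<in>ts ! i. f (i # u))"
    by (rule prod.cong[OF refl]) (simp add: prod.reindex)
  finally show ?thesis .
qed

lemma card_graft:
  assumes "\<forall>s\<in>set ts. finite s"
  shows "card (graft ts) = Suc (\<Sum>i<length ts. card (ts ! i))"
proof -
  have "card (\<Union>i<length ts. Cons i ` (ts ! i)) = (\<Sum>i<length ts. card (Cons i ` (ts ! i)))"
    by (rule card_UN_disjoint) (use assms in auto)
  then show ?thesis
    unfolding graft_def by (subst card_insert_disjoint) (use assms in \<open>auto simp: card_image\<close>)
qed

lemma leaves_graft:
  assumes "\<forall>s\<in>set ts. plane_tree s" 
  shows "leaves (graft ts) = (if ts = [] then {[]} else (\<Union>i<length ts. Cons i ` leaves (ts ! i)))"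
proof -
  have pl: "plane_tree (ts ! i)" if "i < length ts" for i using assms that by simp
  have "u \<in> leaves (graft ts) \<longleftrightarrow> u \<in> (if ts = [] then {[]} else (\<Union>i<length ts. Cons i ` leaves (ts ! i)))" for u
  proof (cases u)
    case Nil
    then show ?thesis
      using outdeg_graft_Nil[OF assms] by (auto simp: leaf_iff_outdeg[OF plane_tree_graft[OF assms]])
  next
    case (Cons i v)
    have "i # v \<in> leaves (graft ts) \<longleftrightarrow> i < length ts \<and> v \<in> leaves (ts ! i)"
      using outdeg_graft_Cons[OF assms, of i v] pl
      by (auto simp: leaf_iff_outdeg[OF plane_tree_graft[OF assms]] leaf_iff_outdeg)
    then show ?thesis unfolding Cons by auto
  qed
  then show ?thesis by blast
qed

lemma finite_leaves: "plane_tree t \<Longrightarrow> finite (leaves t)"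
  by (simp add: leaf_iff_outdeg plane_tree_def)

lemma card_leaves_graft:
  assumes "\<forall>s\<in>set ts. plane_tree s" 
  shows "card (leaves (graft ts)) = (if ts = [] then 1 else (\<Sum>i<length ts. card (leaves (ts ! i))))"
proof -
  have "card (\<Union>i<length ts. Cons i ` leaves (ts ! i)) = (\<Sum>i<length ts. card (Cons i ` leaves (ts ! i)))"
    by (rule card_UN_disjoint) (use assms finite_leaves in auto)
  then show ?thesis
    by (auto simp: leaves_graft[OF assms] card_image)
qed

lemma card_leaves_pos: "plane_tree t \<Longrightarrow> 0 < card (leaves t)"
proof (induction rule: plane_tree_induct)
  case (graft ts)
  show ?case
  proof (cases ts)
    case Nil
    then show ?thesis using card_leaves_graft[of ts] by simp
  next
    case (Cons s ts')
    then have "0 < card (leaves (ts ! 0))" using graft.IH by simp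
    then have "0 < (\<Sum>i<length ts. card (leaves (ts ! i)))"
      by (simp add: Cons sum.lessThan_Suc_shift del: sum.lessThan_Suc)
    then show ?thesis using card_leaves_graft[OF graft.hyps] by simp
  qed
qed

lemma tree_prob_graft:
  assumes "\<forall>s\<in>set ts. plane_tree s"
  shows "tree_prob p (graft ts) = pmf p (length ts) * (\<Prod>i<length ts. tree_prob p (ts ! i))"
proof -
  have "tree_prob p (graft ts) = pmf p (outdeg (graft ts) []) *
      (\<Prod>i<length ts. \<Prod>u\<in>ts ! i. pmf p (outdeg (graft ts) (i # u)))"
    unfolding tree_prob_def by (rule prod_graft) (use assms plane_tree_finite in blast)
  also have "\<dots> = pmf p (length ts) * (\<Prod>i<length ts. tree_prob p (ts ! i))"
    unfolding tree_prob_def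
    by (intro arg_cong2[where f = "(*)"] prod.cong refl)
      (simp_all add: outdeg_graft_Nil[OF assms] outdeg_graft_Cons[OF assms])
  finally show ?thesis .
qed

lemma card_tree_edges:
  assumes t: "plane_tree t"
  shows "card t = Suc (card (tree_edges t))"
proof -
  have ch: "tree_edges t = {(u, w). u \<in> t \<and> (\<exists>i. w = u @ [i] \<and> w \<in> t)}"
    unfolding tree_edges_def using children_plane_tree[OF t] by auto
  have "bij_betw snd (tree_edges t) (t - {[]})"
  proof (intro bij_betwI')
    fix w assume "w \<in> t - {[]}"
    then obtain u i where "w = u @ [i]" "w \<in> t" by (metis Diff_iff rev_exhaust singletonI)
    moreover from this have "u \<in> t" using plane_tree_prefix_closed[OF t, of w u] by simp
    ultimately show "\<exists>x\<in>tree_edges t. w = snd x" unfolding ch by force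
  qed (auto simp: ch)
  then have "card (tree_edges t) = card (t - {[]})" by (rule bij_betw_same_card)
  moreover have "card t = Suc (card (t - {[]}))"
    using t by (intro card.remove) (simp_all add: plane_tree_finite plane_tree_root)
  ultimately show ?thesis by simp
qed

section \<open>Strong embeddings\<close>

text \<open>
  The maps are extensional so that they can be counted. The prefix condition says that the edge from
  \<open>u\<close> to its \<open>i\<close>-th child is stretched to a path that starts with the edge from \<open>\<phi> u\<close> to its \<open>i\<close>-th
  child; since out-degrees agree, every child of \<open>\<phi> u\<close> lies on such a path.
\<close>

definition strong_embeddings ::
  "nat list set \<Rightarrow> nat list set \<Rightarrow> (nat list \<Rightarrow> nat list) set" where
  "strong_embeddings \<tau> t = {\<phi> \<in> \<tau> \<rightarrow>\<^sub>E t. (\<forall>u\<in>\<tau>. outdeg t (\<phi> u) = outdeg \<tau> u) \<and>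
     (\<forall>u i. u @ [i] \<in> \<tau> \<longrightarrow> prefix (\<phi> u @ [i]) (\<phi> (u @ [i])))}"

lemma prefix_snoc_unique:
  assumes "prefix (c @ [i]) z" "prefix (c @ [j]) z"
  shows "i = j"
  using assms by (auto simp: prefix_def)

lemma strict_prefix_snocE:
  assumes "strict_prefix u w"
  obtains i where "prefix (u @ [i]) w"
proof -
  obtain v where v: "w = u @ v" "v \<noteq> []" using assms by (auto simp: strict_prefix_def prefix_def)
  then have "prefix (u @ [hd v]) w" by (metis append.assoc append_Cons append_Nil list.collapse prefixI)
  then show thesis using that by blast
qed

lemma strong_embedding_child:
  assumes t: "plane_tree \<tau>" and \<phi>: "\<phi> \<in> strong_embeddings \<tau> t" and y: "y \<in> \<tau>" "prefix (x @ [i]) y"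
  shows "prefix (\<phi> x @ [i]) (\<phi> y)"
  using y
proof (induction y rule: rev_induct)
  case (snoc k y)
  have step: "prefix (\<phi> y @ [k]) (\<phi> (y @ [k]))"
    using \<phi> snoc.prems(1) unfolding strong_embeddings_def by blast
  show ?case
  proof (cases "x @ [i] = y @ [k]")
    case True
    then show ?thesis using step by simp
  next
    case False
    then have "prefix (x @ [i]) y" using snoc.prems(2) by (auto simp: prefix_snoc)
    moreover have "y \<in> \<tau>" using plane_tree_prefix_closed[OF t snoc.prems(1)] by simp
    ultimately have "prefix (\<phi> x @ [i]) (\<phi> y)" using snoc.IH by blast
    then show ?thesis using step by (meson append_prefixD prefix_order.trans)
  qed
qed simp

text \<open>
  Ancestors go to ancestors along the stretched edges. Conversely, two vertices that separate at \<open>c\<close> have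
  images that separate at \<open>\<phi> c\<close>, because different child positions are kept apart.
\<close>

lemma strong_embedding_prefix_iff:
  assumes t: "plane_tree \<tau>" and \<phi>: "\<phi> \<in> strong_embeddings \<tau> t" and x: "x \<in> \<tau>" and y: "y \<in> \<tau>"
  shows "prefix (\<phi> x) (\<phi> y) \<longleftrightarrow> prefix x y"
proof
  assume "prefix x y"
  show "prefix (\<phi> x) (\<phi> y)"
  proof (cases "x = y")
    case False
    then obtain i where "prefix (x @ [i]) y"
      using \<open>prefix x y\<close> strict_prefix_snocE[of x y] by (auto simp: strict_prefix_def)
    then show ?thesis
      using strong_embedding_child[OF t \<phi> y] by (meson append_prefixD)
  qed simp
next
  assume *: "prefix (\<phi> x) (\<phi> y)"
  show "prefix x y"
  proof (rule ccontr)
    assume n: "\<not> prefix x y"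
    then consider "strict_prefix y x" | "x \<parallel> y" unfolding parallel_def strict_prefix_def by blast
    then show False
    proof cases
      case 1
      then obtain i where "prefix (y @ [i]) x" by (rule strict_prefix_snocE)
      then have "prefix (\<phi> y @ [i]) (\<phi> x)" by (rule strong_embedding_child[OF t \<phi> x])
      then show False using * by (auto simp: prefix_def)
    next
      case 2
      then obtain c i x' j y' where c: "i \<noteq> j" "x = c @ i # x'" "y = c @ j # y'"
        using parallel_decomp by blast
      have "prefix (\<phi> c @ [i]) (\<phi> x)"
        by (rule strong_embedding_child[OF t \<phi> x]) (simp add: c)
      then have "prefix (\<phi> c @ [i]) (\<phi> y)" using * by (meson prefix_order.trans)
      moreover have "prefix (\<phi> c @ [j]) (\<phi> y)"
        by (rule strong_embedding_child[OF t \<phi> y]) (simp add: c)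
      ultimately show False using c(1) prefix_snoc_unique by metis
    qed
  qed
qed

lemma strong_embedding_inj_on:
  assumes "plane_tree \<tau>" "\<phi> \<in> strong_embeddings \<tau> t"
  shows "inj_on \<phi> \<tau>"
  using strong_embedding_prefix_iff[OF assms]
  by (metis inj_onI prefix_order.order_antisym prefix_order.order_refl)

lemma strong_embedding_leaf:
  assumes "plane_tree \<tau>" "plane_tree t" "\<phi> \<in> strong_embeddings \<tau> t" "u \<in> leaves \<tau>"
  shows "\<phi> u \<in> leaves t"
  using assms unfolding leaf_iff_outdeg[OF assms(1)] leaf_iff_outdeg[OF assms(2)]
  by (auto simp: strong_embeddings_def)

lemma finite_strong_embeddings:
  assumes "plane_tree \<tau>" "plane_tree t"
  shows "finite (strong_embeddings \<tau> t)"
proof -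
  have "finite (\<tau> \<rightarrow>\<^sub>E t)" using assms by (intro finite_PiE) (simp_all add: plane_tree_finite)
  then show ?thesis by (rule rev_finite_subset) (auto simp: strong_embeddings_def)
qed

lemma leaf_below:
  assumes t: "plane_tree t" and u: "u \<in> t"
  obtains s where "s \<in> leaves t" "prefix u s"
proof -
  have "finite t" using t by (rule plane_tree_finite)
  then have fin: "finite (length ` {s \<in> t. prefix u s})" by simp
  have "length ` {s \<in> t. prefix u s} \<noteq> {}" using u by blast
  from Max_in[OF fin this] obtain s where s: "s \<in> t" "prefix u s"
    and s_max: "length s = Max (length ` {s \<in> t. prefix u s})" by auto
  have max: "length w \<le> length s" if "w \<in> t" "prefix u w" for w
    unfolding s_max by (rule Max_ge[OF fin]) (use that in blast)
  have "s @ [i] \<notin> t" for i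
    using max[of "s @ [i]"] s(2) by (auto simp: prefix_def)
  then have "s \<in> leaves t" unfolding leaves_def using s children_plane_tree[OF t] by auto
  then show thesis using that s by blast
qed

text \<open>
  Without unary vertices the images of the leaves determine the images of all vertices: \<open>\<phi> u\<close> must be
  the point at which the paths to the leaves below two different children of \<open>u\<close> separate.
\<close>

lemma strong_embedding_unique:
  assumes \<tau>: "plane_tree \<tau>" and bin: "\<And>u. u \<in> \<tau> - leaves \<tau> \<Longrightarrow> outdeg \<tau> u \<ge> 2"
    and \<phi>: "\<phi> \<in> strong_embeddings \<tau> t" and \<psi>: "\<psi> \<in> strong_embeddings \<tau> t"
    and eq: "\<And>u. u \<in> leaves \<tau> \<Longrightarrow> \<phi> u = \<psi> u"
  shows "\<phi> = \<psi>"
proof -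
  \<comment> \<open>If \<open>\<psi> u\<close> were strictly below \<open>\<phi> u\<close>, say in direction \<open>k\<close>, then all leaves below \<open>u\<close> would
    have their images in direction \<open>k\<close> from \<open>\<phi> u\<close>, so that \<open>u\<close> had only one child.\<close>
  have no_strict: "\<not> strict_prefix (\<phi> u) (\<psi> u)"
    if u: "u \<in> \<tau>" "u \<notin> leaves \<tau>" and \<phi>: "\<phi> \<in> strong_embeddings \<tau> t"
      and \<psi>: "\<psi> \<in> strong_embeddings \<tau> t"
      and eq: "\<And>u. u \<in> leaves \<tau> \<Longrightarrow> \<phi> u = \<psi> u" for u \<phi> \<psi>
  proof
    assume "strict_prefix (\<phi> u) (\<psi> u)"
    then obtain k where k: "prefix (\<phi> u @ [k]) (\<psi> u)" by (rule strict_prefix_snocE)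
    have "i = k" if i: "u @ [i] \<in> \<tau>" for i
    proof -
      obtain s where s: "s \<in> leaves \<tau>" "prefix (u @ [i]) s" using leaf_below[OF \<tau> i] .
      have s': "s \<in> \<tau>" using s by (simp add: leaves_def)
      have "prefix (\<psi> u) (\<psi> s)"
        using strong_embedding_prefix_iff[OF \<tau> \<psi> u(1) s'] s(2) by (meson append_prefixD)
      then have "prefix (\<phi> u @ [k]) (\<phi> s)" using k eq[OF s(1)] by (metis prefix_order.trans)
      then show "i = k"
        by (rule prefix_snoc_unique[OF strong_embedding_child[OF \<tau> \<phi> s' s(2)]])
    qed
    moreover have "u @ [0] \<in> \<tau>" "u @ [1] \<in> \<tau>"
      using child_iff_less_outdeg[OF \<tau> u(1)] bin[of u] u by auto
    ultimately show False by (metis zero_neq_one)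
  qed
  have "\<phi> u = \<psi> u" if u: "u \<in> \<tau>" for u
  proof (cases "u \<in> leaves \<tau>")
    case False
    obtain s where s: "s \<in> leaves \<tau>" "prefix u s" using leaf_below[OF \<tau> u] .
    have s': "s \<in> \<tau>" using s by (simp add: leaves_def)
    have "prefix (\<phi> u) (\<phi> s)" "prefix (\<psi> u) (\<phi> s)"
      using strong_embedding_prefix_iff[OF \<tau> \<phi> u s'] strong_embedding_prefix_iff[OF \<tau> \<psi> u s']
        s eq[OF s(1)] by auto
    then have "prefix (\<phi> u) (\<psi> u) \<or> prefix (\<psi> u) (\<phi> u)" by (rule prefix_same_cases)
    moreover have "\<not> strict_prefix (\<phi> u) (\<psi> u)" "\<not> strict_prefix (\<psi> u) (\<phi> u)"
      using no_strict[OF u False \<phi> \<psi> eq] no_strict[OF u False \<psi> \<phi> eq[symmetric]] by auto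
    ultimately show ?thesis by (auto simp: strict_prefix_def)
  qed (use eq in auto)
  moreover have "\<phi> \<in> extensional \<tau>" "\<psi> \<in> extensional \<tau>"
    using \<phi> \<psi> by (auto simp: strong_embeddings_def PiE_def)
  ultimately show ?thesis by (meson extensionalityI)
qed

section \<open>Counting strong embeddings\<close>

text \<open>
  If the root goes to the root, the out-degrees force equally many branches, and the branch at position \<open>i\<close>
  is embedded into the branch at position \<open>i\<close>. The choices for different branches are independent.
\<close>

lemma card_root_embeddings:
  assumes ss: "\<forall>s\<in>set ss. plane_tree s" and ts: "\<forall>s\<in>set ts. plane_tree s"
  shows "card {\<phi> \<in> strong_embeddings (graft ss) (graft ts). \<phi> [] = []} =
    (if length ss = length ts then \<Prod>i<length ss. card (strong_embeddings (ss ! i) (ts ! i)) else 0)"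
proof (cases "length ss = length ts")
  case False
  have "outdeg (graft ts) [] \<noteq> outdeg (graft ss) []"
    using False outdeg_graft_Nil[OF ss] outdeg_graft_Nil[OF ts] by simp
  then have "{\<phi> \<in> strong_embeddings (graft ss) (graft ts). \<phi> [] = []} = {}"
    by (auto simp: strong_embeddings_def) (metis Nil_in_graft)
  then show ?thesis using False by (simp only: card.empty if_False)
next
  case True
  let ?k = "length ss"
  define E where "E = {\<phi> \<in> strong_embeddings (graft ss) (graft ts). \<phi> [] = []}"
  define F where "F = (\<Pi>\<^sub>E i\<in>{..<?k}. strong_embeddings (ss ! i) (ts ! i))"
  define split where "split \<phi> = (\<lambda>i\<in>{..<?k}. \<lambda>u\<in>ss ! i. tl (\<phi> (i # u)))"
    for \<phi> :: "nat list \<Rightarrow> nat list"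
  define join where "join g = (\<lambda>w\<in>graft ss. case w of [] \<Rightarrow> [] | i # u \<Rightarrow> i # g i u)"
    for g :: "nat \<Rightarrow> nat list \<Rightarrow> nat list"
  have ps: "plane_tree (ss ! i)" if "i < ?k" for i using ss that by simp
  have hd: "\<phi> (i # u) = i # tl (\<phi> (i # u))" if "\<phi> \<in> E" "i < ?k" "u \<in> ss ! i" for \<phi> i u
  proof -
    have "prefix (\<phi> [] @ [i]) (\<phi> (i # u))"
      by (rule strong_embedding_child[OF plane_tree_graft[OF ss]])
        (use that in \<open>auto simp: E_def\<close>)
    then show ?thesis using that by (auto simp: E_def prefix_def)
  qed
  have "bij_betw split E F"
  proof (rule bij_betw_byWitness[where f' = join])
    show "\<forall>\<phi>\<in>E. join (split \<phi>) = \<phi>"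
    proof
      fix \<phi> assume \<phi>: "\<phi> \<in> E"
      have "join (split \<phi>) w = \<phi> w" for w
      proof (cases "w \<in> graft ss")
        case True
        then show ?thesis
          using \<phi> hd[OF \<phi>] by (cases w) (auto simp: join_def split_def E_def)
      next
        case False
        then show ?thesis using \<phi>
          by (auto simp: join_def E_def strong_embeddings_def PiE_def extensional_def)
      qed
      then show "join (split \<phi>) = \<phi>" by blast
    qed
    show "\<forall>g\<in>F. split (join g) = g"
    proof (intro ballI ext)
      fix g i u assume g: "g \<in> F"
      show "split (join g) i u = g i u"
      proof (cases "i < ?k")
        case True
        then have "g i \<in> strong_embeddings (ss ! i) (ts ! i)" using g by (auto simp: F_def)
        then show ?thesis using True
          by (auto simp: split_def join_def strong_embeddings_def PiE_def extensional_def)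
      next
        case False
        then show ?thesis using g by (auto simp: split_def F_def PiE_def extensional_def)
      qed
    qed
    show "split ` E \<subseteq> F"
    proof (intro image_subsetI)
      fix \<phi> assume \<phi>: "\<phi> \<in> E"
      have "(\<lambda>u\<in>ss ! i. tl (\<phi> (i # u))) \<in> strong_embeddings (ss ! i) (ts ! i)" if i: "i < ?k" for i
      proof -
        have in_t: "tl (\<phi> (i # u)) \<in> ts ! i" if "u \<in> ss ! i" for u
        proof -
          have "\<phi> (i # u) \<in> graft ts" using \<phi> i that by (auto simp: E_def strong_embeddings_def)
          then show ?thesis using hd[OF \<phi> i that] by (metis Cons_in_graft)
        qed
        moreover have "outdeg (ts ! i) (tl (\<phi> (i # u))) = outdeg (ss ! i) u" if u: "u \<in> ss ! i" for u
        proof -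
          have "outdeg (graft ts) (\<phi> (i # u)) = outdeg (graft ss) (i # u)"
            using \<phi> i u by (auto simp: E_def strong_embeddings_def)
          then have "outdeg (graft ts) (i # tl (\<phi> (i # u))) = outdeg (graft ss) (i # u)"
            using hd[OF \<phi> i u] by simp
          then show ?thesis
            using outdeg_graft_Cons[OF ts _ in_t[OF u]] outdeg_graft_Cons[OF ss i u] i True by simp
        qed
        moreover have "prefix (tl (\<phi> (i # u)) @ [j]) (tl (\<phi> (i # u @ [j])))" if u: "u @ [j] \<in> ss ! i" for u j
        proof -
          have u': "u \<in> ss ! i" using plane_tree_prefix_closed[OF ps[OF i] u] by simp
          have "prefix (\<phi> (i # u) @ [j]) (\<phi> (i # u @ [j]))"
            using \<phi> i u unfolding E_def strong_embeddings_def
            by (metis (no_types, lifting) Cons_in_graft append_Cons mem_Collect_eq)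
          then show ?thesis using hd[OF \<phi> i u] hd[OF \<phi> i u'] by (metis Cons_prefix_Cons append_Cons)
        qed
        moreover have "u \<in> ss ! i" if "u @ [j] \<in> ss ! i" for u j
          using plane_tree_prefix_closed[OF ps[OF i] that] by simp
        ultimately show ?thesis unfolding strong_embeddings_def by auto
      qed
      then show "split \<phi> \<in> F" by (auto simp: split_def F_def)
    qed
    show "join ` F \<subseteq> E"
    proof (intro image_subsetI)
      fix g assume g: "g \<in> F"
      have gi: "g i \<in> strong_embeddings (ss ! i) (ts ! i)" if "i < ?k" for i
        using g that by (auto simp: F_def)
      have join_Nil: "join g [] = []" by (simp add: join_def)
      have join_Cons: "join g (i # u) = i # g i u" if "i < ?k" "u \<in> ss ! i" for i u
        using that by (simp add: join_def)
      have "join g w \<in> graft ts \<and> outdeg (graft ts) (join g w) = outdeg (graft ss) w"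
        if w: "w \<in> graft ss" for w
      proof (cases w)
        case Nil
        then show ?thesis
          using join_Nil True outdeg_graft_Nil[OF ss] outdeg_graft_Nil[OF ts] by simp
      next
        case (Cons i u)
        then have i: "i < ?k" "u \<in> ss ! i" using w by auto
        have "g i u \<in> ts ! i" "outdeg (ts ! i) (g i u) = outdeg (ss ! i) u"
          using gi[OF i(1)] i(2) by (auto simp: strong_embeddings_def)
        then show ?thesis
          using i True outdeg_graft_Cons[OF ts] outdeg_graft_Cons[OF ss i] by (simp add: Cons join_Cons)
      qed
      moreover have "prefix (join g w @ [j]) (join g (w @ [j]))" if w: "w @ [j] \<in> graft ss" for w j
      proof (cases w)
        case Nil
        then show ?thesis using w by (auto simp: join_Nil join_Cons)
      next
        case (Cons i u)
        then have i: "i < ?k" "u @ [j] \<in> ss ! i" using w by auto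
        have "u \<in> ss ! i" using plane_tree_prefix_closed[OF ps[OF i(1)] i(2)] by simp
        moreover have "prefix (g i u @ [j]) (g i (u @ [j]))"
          using gi[OF i(1)] i(2) by (auto simp: strong_embeddings_def)
        ultimately show ?thesis using i by (simp add: Cons join_Cons)
      qed
      moreover have "join g \<in> extensional (graft ss)" by (simp add: join_def)
      ultimately show "join g \<in> E"
        unfolding E_def strong_embeddings_def PiE_def by (auto simp: join_Nil)
    qed
  qed
  then have "card E = card F" by (rule bij_betw_same_card)
  also have "card F = (\<Prod>i<?k. card (strong_embeddings (ss ! i) (ts ! i)))"
    unfolding F_def by (subst card_PiE) auto
  finally show ?thesis using True by (simp add: E_def)
qed

text \<open>
  The whole image lies below the image of the root, so it stays within one branch.
\<close>

lemma card_nonroot_embeddings: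
  assumes \<tau>: "plane_tree \<tau>" and ts: "\<forall>s\<in>set ts. plane_tree s" and i: "i < length ts"
  shows "card {\<phi> \<in> strong_embeddings \<tau> (graft ts). prefix [i] (\<phi> [])} =
    card (strong_embeddings \<tau> (ts ! i))"
proof -
  let ?E = "{\<phi> \<in> strong_embeddings \<tau> (graft ts). prefix [i] (\<phi> [])}"
  have root: "[] \<in> \<tau>" using \<tau> by (rule plane_tree_root)
  define down where "down \<phi> = (\<lambda>u\<in>\<tau>. tl (\<phi> u))" for \<phi> :: "nat list \<Rightarrow> nat list"
  define up where "up \<phi> = (\<lambda>u\<in>\<tau>. i # \<phi> u)" for \<phi> :: "nat list \<Rightarrow> nat list"
  have closed: "u \<in> \<tau>" if "u @ [j] \<in> \<tau>" for u j
    using plane_tree_prefix_closed[OF \<tau> that] by simp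
  have hd: "\<phi> u = i # tl (\<phi> u)" if "\<phi> \<in> ?E" "u \<in> \<tau>" for \<phi> u
  proof -
    have "prefix [i] (\<phi> [])" using that(1) by simp
    moreover have "prefix (\<phi> []) (\<phi> u)"
      using that strong_embedding_prefix_iff[OF \<tau> _ root that(2)] by auto
    ultimately have "prefix [i] (\<phi> u)" by (rule prefix_order.trans)
    then show ?thesis by (auto simp: prefix_def)
  qed
  have "bij_betw down ?E (strong_embeddings \<tau> (ts ! i))"
  proof (rule bij_betw_byWitness[where f' = up])
    show "\<forall>\<phi>\<in>?E. up (down \<phi>) = \<phi>"
    proof (intro ballI ext)
      fix \<phi> u assume \<phi>: "\<phi> \<in> ?E"
      show "up (down \<phi>) u = \<phi> u"
        using hd[OF \<phi>, of u] \<phi>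
        by (cases "u \<in> \<tau>") (auto simp: up_def down_def strong_embeddings_def PiE_def extensional_def)
    qed
    show "\<forall>\<phi>\<in>strong_embeddings \<tau> (ts ! i). down (up \<phi>) = \<phi>"
      by (auto simp: up_def down_def strong_embeddings_def PiE_def extensional_def fun_eq_iff)
    show "down ` ?E \<subseteq> strong_embeddings \<tau> (ts ! i)"
    proof (intro image_subsetI)
      fix \<phi> assume \<phi>: "\<phi> \<in> ?E"
      have in_t: "tl (\<phi> u) \<in> ts ! i" if "u \<in> \<tau>" for u
      proof -
        have "\<phi> u \<in> graft ts" using \<phi> that by (auto simp: strong_embeddings_def)
        then show ?thesis using hd[OF \<phi> that] by (metis Cons_in_graft)
      qed
      moreover have "outdeg (ts ! i) (tl (\<phi> u)) = outdeg \<tau> u" if u: "u \<in> \<tau>" for u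
      proof -
        have "outdeg (graft ts) (i # tl (\<phi> u)) = outdeg \<tau> u"
          using \<phi> u hd[OF \<phi> u] by (auto simp: strong_embeddings_def)
        then show ?thesis using outdeg_graft_Cons[OF ts i in_t[OF u]] by simp
      qed
      moreover have "prefix (tl (\<phi> u) @ [j]) (tl (\<phi> (u @ [j])))" if u: "u @ [j] \<in> \<tau>" for u j
      proof -
        have "prefix (\<phi> u @ [j]) (\<phi> (u @ [j]))"
          using \<phi> u unfolding strong_embeddings_def by blast
        then show ?thesis
          using hd[OF \<phi> u] hd[OF \<phi> closed[OF u]] by (metis Cons_prefix_Cons append_Cons)
      qed
      ultimately show "down \<phi> \<in> strong_embeddings \<tau> (ts ! i)"
        unfolding strong_embeddings_def down_def using closed by auto
    qed
    show "up ` strong_embeddings \<tau> (ts ! i) \<subseteq> ?E"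
    proof (intro image_subsetI)
      fix \<phi> assume \<phi>: "\<phi> \<in> strong_embeddings \<tau> (ts ! i)"
      have in_t: "\<phi> u \<in> ts ! i" if "u \<in> \<tau>" for u
        using \<phi> that by (auto simp: strong_embeddings_def)
      have "outdeg (graft ts) (i # \<phi> u) = outdeg \<tau> u" if u: "u \<in> \<tau>" for u
        using outdeg_graft_Cons[OF ts i in_t[OF u]] \<phi> u by (auto simp: strong_embeddings_def)
      moreover have "prefix (\<phi> u @ [j]) (\<phi> (u @ [j]))" if "u @ [j] \<in> \<tau>" for u j
        using \<phi> that unfolding strong_embeddings_def by blast
      ultimately show "up \<phi> \<in> ?E"
        unfolding strong_embeddings_def up_def using closed root in_t i by auto
    qed
  qed
  then show ?thesis by (rule bij_betw_same_card)
qed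

lemma card_strong_embeddings_graft:
  assumes ss: "\<forall>s\<in>set ss. plane_tree s" and ts: "\<forall>s\<in>set ts. plane_tree s"
  shows "card (strong_embeddings (graft ss) (graft ts)) =
    (if length ss = length ts then \<Prod>i<length ss. card (strong_embeddings (ss ! i) (ts ! i)) else 0)
    + (\<Sum>i<length ts. card (strong_embeddings (graft ss) (ts ! i)))"
proof -
  let ?E = "strong_embeddings (graft ss) (graft ts)"
  let ?N = "\<lambda>i. {\<phi> \<in> ?E. prefix [i] (\<phi> [])}"
  have fin: "finite ?E" by (intro finite_strong_embeddings plane_tree_graft ss ts)
  have split: "?E = {\<phi> \<in> ?E. \<phi> [] = []} \<union> (\<Union>i<length ts. ?N i)"
  proof (intro equalityI subsetI)
    fix \<phi> assume \<phi>: "\<phi> \<in> ?E"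
    then have "\<phi> [] \<in> graft ts" by (auto simp: strong_embeddings_def)
    then show "\<phi> \<in> {\<phi> \<in> ?E. \<phi> [] = []} \<union> (\<Union>i<length ts. ?N i)"
      using \<phi> by (cases "\<phi> []") auto
  qed auto
  have "card ?E = card {\<phi> \<in> ?E. \<phi> [] = []} + card (\<Union>i<length ts. ?N i)"
    by (subst split, rule card_Un_disjoint) (use fin in auto)
  also have "card (\<Union>i<length ts. ?N i) = (\<Sum>i<length ts. card (?N i))"
    by (rule card_UN_disjoint) (use fin in \<open>auto simp: prefix_def\<close>)
  also have "\<dots> = (\<Sum>i<length ts. card (strong_embeddings (graft ss) (ts ! i)))"
    by (intro sum.cong refl card_nonroot_embeddings plane_tree_graft ss ts) auto
  finally show ?thesis using card_root_embeddings[OF ss ts] by simp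
qed

section \<open>Induced trees are strongly embedded trees\<close>

lemma outdeg_neq_1:
  assumes "x \<in> children W u" "y \<in> children W u" "x \<noteq> y"
  shows "outdeg W u \<noteq> 1"
proof
  assume "outdeg W u = 1"
  then obtain z where "children W u = {z}" unfolding outdeg_def by (rule card_1_singletonE)
  then show False using assms by simp
qed

lemma labelled_leaves_subset: "labelled_leaves t L S \<subseteq> t"
  by (auto simp: labelled_leaves_def leaves_def)

lemma lca_subtree_subset: "lca_subtree t L S \<subseteq> t"
  by (auto simp: lca_subtree_def)

lemma convex_lca_subtree:
  assumes "plane_tree t"
  shows "convex_nodes (lca_subtree t L S)"
  unfolding convex_nodes_def
proof (intro ballI allI impI)
  fix u w z
  assume u: "u \<in> lca_subtree t L S" and w: "w \<in> lca_subtree t L S" and z: "prefix u z \<and> prefix z w"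
  obtain s where s: "s \<in> labelled_leaves t L S" "prefix w s" and wt: "w \<in> t"
    using w by (auto simp: lca_subtree_def)
  have "z \<in> t" using plane_tree_prefix_closed[OF assms wt] z by simp
  moreover have "prefix (lca t L S) z"
    using u z prefix_order.trans[of "lca t L S" u z] by (simp add: lca_subtree_def)
  moreover have "prefix z s" using z s(2) prefix_order.trans[of z w s] by simp
  ultimately show "z \<in> lca_subtree t L S" using s(1) by (auto simp: lca_subtree_def)
qed

lemma lca_in_lca_subtree:
  assumes "plane_tree t" "labelled_leaves t L S \<noteq> {}"
  shows "lca t L S \<in> lca_subtree t L S"
proof -
  obtain s where s: "s \<in> labelled_leaves t L S" using assms(2) by blast
  have "prefix (lca t L S) s" unfolding lca_def by (rule Longest_common_prefix_prefix[OF s])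
  then show ?thesis
    unfolding lca_subtree_def
    using s plane_tree_prefix_closed[OF assms(1)] labelled_leaves_subset by blast
qed

text \<open>
  In the LCA subtree every vertex other than the root has exactly one parent, so total degree 2
  means having exactly one child.
\<close>

lemma suppress_lca_subtree:
  assumes t: "plane_tree t" and ne: "labelled_leaves t L S \<noteq> {}"
  defines "W \<equiv> lca_subtree t L S"
  shows "suppress (lca t L S) W = {u \<in> W. u = lca t L S \<or> outdeg W u \<noteq> 1}"
proof -
  have conv: "convex_nodes W" unfolding W_def by (rule convex_lca_subtree[OF t])
  have "card {z \<in> W. u \<in> children W z} = 1" if u: "u \<in> W" "u \<noteq> lca t L S" for u
  proof -
    have le: "prefix (lca t L S) u" using u by (simp add: W_def lca_subtree_def)
    then obtain v i where v: "u = v @ [i]" using u(2) by (cases u rule: rev_cases) auto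
    then have lev: "prefix (lca t L S) v" using le u(2) by (simp add: prefix_snoc)
    have "v \<in> W"
      by (rule convex_nodesD[OF conv _ u(1) lev])
        (use lca_in_lca_subtree[OF t ne] v in \<open>simp_all add: W_def\<close>)
    then have "{z \<in> W. u \<in> children W z} = {v}"
      using children_convex[OF conv] u(1) v by auto
    then show ?thesis by simp
  qed
  then show ?thesis unfolding suppress_def total_degree_def by auto
qed

text \<open>
  Used for child positions: an order-preserving injection between the children of two vertices of the same
  out-degree keeps the positions.
\<close>

lemma strict_mono_endo_lessThan:
  fixes j :: "nat \<Rightarrow> nat"
  assumes mono: "\<And>i i'. i < i' \<Longrightarrow> i' < k \<Longrightarrow> j i < j i'" and range: "\<And>i. i < k \<Longrightarrow> j i < k"
    and i: "i < k"
  shows "j i = i"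
proof -
  have gap: "j a + d \<le> j (a + d)" if "a + d < k" for a d
    using that
  proof (induction d)
    case (Suc d)
    then have "j (a + d) < j (a + Suc d)" by (intro mono) auto
    then show ?case using Suc by simp
  qed simp
  have "i \<le> j i" using gap[of 0 i] i by simp
  moreover have "j i + (k - 1 - i) \<le> j (k - 1)" using gap[of i "k - 1 - i"] i by simp
  moreover have "j (k - 1) < k" using range i by simp
  ultimately show ?thesis using i by simp
qed

lemma lexord_branch:
  assumes "prefix (c @ [i]) x" "prefix (c @ [j]) y" "i < j"
  shows "(x, y) \<in> lexord less_than"
proof -
  obtain x' y' where "x = c @ i # x'" "y = c @ j # y'" using assms(1,2) by (auto simp: prefix_def)
  then show ?thesis using assms(3) by (auto simp: lexord_def)
qed

text \<open>
  An isomorphism onto the suppressed subtree sends the children of \<open>u\<close> to minimal descendants of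
  \<open>\<phi> u\<close> in that subtree. No two of them lie at or below the same child of \<open>\<phi> u\<close> in \<open>t\<close>, since the vertex at
  which they separate would not have been suppressed. As \<open>\<phi> u\<close> has exactly as many children in \<open>t\<close> as \<open>u\<close>
  has in \<open>\<tau>\<close>, and \<open>\<phi>\<close> respects the order, the \<open>i\<close>-th child of \<open>u\<close> goes to or below the \<open>i\<close>-th
  child of \<open>\<phi> u\<close>.
\<close>

lemma induces_imp_strong_embedding:
  assumes \<tau>: "plane_tree \<tau>" and t: "plane_tree t" and ne: "labelled_leaves t L S \<noteq> {}"
    and iso: "labelled_tree_iso \<phi> [] \<tau> lab
             (lca t L S) (suppress (lca t L S) (lca_subtree t L S)) L"
    and deg: "\<forall>u\<in>\<tau>. outdeg t (\<phi> u) = outdeg \<tau> u"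
  shows "restrict \<phi> \<tau> \<in> strong_embeddings \<tau> t"
proof -
  define r where "r = lca t L S"
  define W where "W = lca_subtree t L S"
  define W' where "W' = suppress r W"
  have W': "W' = {u \<in> W. u = r \<or> outdeg W u \<noteq> 1}"
    unfolding W'_def r_def W_def by (rule suppress_lca_subtree[OF t ne])
  have sub: "W' \<subseteq> W" "W \<subseteq> t" using W' lca_subtree_subset by (auto simp: W_def)
  have conv: "convex_nodes W" unfolding W_def by (rule convex_lca_subtree[OF t])
  have bij: "bij_betw \<phi> \<tau> W'"
    and ch: "\<And>u w. u \<in> \<tau> \<Longrightarrow> w \<in> \<tau> \<Longrightarrow> w \<in> children \<tau> u \<longleftrightarrow> \<phi> w \<in> children W' (\<phi> u)"
    and lex: "\<And>u w z. u \<in> \<tau> \<Longrightarrow> w \<in> children \<tau> u \<Longrightarrow> z \<in> children \<tau> u \<Longrightarrow>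
        (w, z) \<in> lexord less_than \<Longrightarrow> (\<phi> w, \<phi> z) \<in> lexord less_than"
    using iso unfolding labelled_tree_iso_def W'_def r_def W_def by auto
  have \<phi>W': "\<phi> u \<in> W'" if "u \<in> \<tau>" for u using bij that by (auto simp: bij_betw_def)
  \<comment> \<open>Two children of \<open>v\<close> in the suppressed subtree below the same child of \<open>v\<close> in the tree are equal:
    otherwise the vertex \<open>m\<close> where they separate has two children in the LCA subtree, hence is
    not suppressed, and lies strictly between \<open>v\<close> and both of them.\<close>
  have meet: "x = y"
    if x: "x \<in> children W' v" and y: "y \<in> children W' v" and v: "v \<in> W'"
      and j: "prefix (v @ [j]) x" "prefix (v @ [j]) y" for x y v j
  proof (rule ccontr)
    assume "x \<noteq> y"
    have xW: "x \<in> W'" "strict_prefix v x" "\<And>z. z \<in> W' \<Longrightarrow> strict_prefix v z \<Longrightarrow> \<not> strict_prefix z x"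
      and yW: "y \<in> W'" "strict_prefix v y" "\<And>z. z \<in> W' \<Longrightarrow> strict_prefix v z \<Longrightarrow> \<not> strict_prefix z y"
      using x y unfolding children_def by blast+
    have "x \<parallel> y"
      using xW yW \<open>x \<noteq> y\<close> unfolding parallel_def strict_prefix_def by blast
    then obtain m a x' b y' where m: "a \<noteq> b" "x = m @ a # x'" "y = m @ b # y'"
      using parallel_decomp by blast
    have "prefix (v @ [j]) m"
    proof (rule ccontr)
      assume "\<not> prefix (v @ [j]) m"
      moreover have "prefix (v @ [j]) m \<or> prefix m (v @ [j])"
        by (rule prefix_same_cases[OF j(1)]) (simp add: m)
      ultimately have "strict_prefix m (v @ [j])" by (auto simp: strict_prefix_def)
      then obtain e where e: "prefix (m @ [e]) (v @ [j])" by (rule strict_prefix_snocE)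
      have "e = a" by (rule prefix_snoc_unique[OF prefix_order.trans[OF e j(1)]]) (simp add: m)
      moreover have "e = b"
        by (rule prefix_snoc_unique[OF prefix_order.trans[OF e j(2)]]) (simp add: m)
      ultimately show False using m(1) by simp
    qed
    then have vm: "strict_prefix v m" by (auto simp: strict_prefix_def prefix_def)
    have mx: "strict_prefix m x" using m by (auto simp: strict_prefix_def prefix_def)
    have in_W: "z \<in> W" if "prefix v z" "prefix z x \<or> prefix z y" for z
      using convex_nodesD[OF conv _ _ that(1)] sub v xW(1) yW(1) that(2) by blast
    have "m \<in> W" using vm mx by (intro in_W) (auto simp: strict_prefix_def)
    have "prefix v (m @ [c])" for c using vm by (auto simp: strict_prefix_def prefix_def)
    moreover have "prefix (m @ [a]) x" "prefix (m @ [b]) y" using m by auto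
    ultimately have "m @ [a] \<in> W" "m @ [b] \<in> W" using in_W by blast+
    then have "m @ [a] \<in> children W m" "m @ [b] \<in> children W m"
      using children_convex[OF conv \<open>m \<in> W\<close>] by auto
    then have "outdeg W m \<noteq> 1" by (rule outdeg_neq_1) (use m(1) in simp)
    then have "m \<in> W'" using \<open>m \<in> W\<close> by (simp add: W')
    then show False using xW(3) vm mx by blast
  qed
  have "prefix (\<phi> u @ [i]) (\<phi> (u @ [i]))" if ui: "u @ [i] \<in> \<tau>" for u i
  proof -
    have u: "u \<in> \<tau>" using plane_tree_parent[OF \<tau> ui] .
    define k where "k = outdeg \<tau> u"
    have k: "u @ [l] \<in> \<tau> \<longleftrightarrow> l < k" "u @ [l] \<in> children \<tau> u \<longleftrightarrow> l < k" for l
      using child_iff_less_outdeg[OF \<tau> u] children_plane_tree[OF \<tau> u] by (auto simp: k_def)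
    have child: "\<phi> (u @ [l]) \<in> children W' (\<phi> u)" if "l < k" for l
      using ch[OF u, of "u @ [l]"] k that by simp
    have "\<exists>j. prefix (\<phi> u @ [j]) (\<phi> (u @ [l]))" if "l < k" for l
      using child[OF that] strict_prefix_snocE unfolding children_def by blast
    then obtain j where j: "\<And>l. l < k \<Longrightarrow> prefix (\<phi> u @ [j l]) (\<phi> (u @ [l]))" by metis
    have "j i = i"
    proof (rule strict_mono_endo_lessThan[where k = k])
      fix l l' assume l: "l < l'" "l' < k"
      have "(u @ [l], u @ [l']) \<in> lexord less_than" using l by (auto simp: lexord_append_leftI)
      then have lx: "(\<phi> (u @ [l]), \<phi> (u @ [l'])) \<in> lexord less_than"
        using lex[OF u] k l by simp
      have "\<not> j l' < j l"
      proof
        assume "j l' < j l"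
        then have "(\<phi> (u @ [l']), \<phi> (u @ [l])) \<in> lexord less_than"
          using lexord_branch[OF j j] l by simp
        then have "(\<phi> (u @ [l]), \<phi> (u @ [l])) \<in> lexord less_than"
          by (rule lexord_trans[OF lx _ trans_less_than])
        then show False by (simp add: lexord_irreflexive)
      qed
      moreover have "j l \<noteq> j l'"
      proof
        assume "j l = j l'"
        then have "\<phi> (u @ [l]) = \<phi> (u @ [l'])"
          using meet[OF child[of l] child[of l'] \<phi>W'[OF u] j[of l]] j[of l'] l by simp
        moreover have "u @ [l] \<in> \<tau>" "u @ [l'] \<in> \<tau>" using l k by simp_all
        ultimately have "u @ [l] = u @ [l']"
          by (rule inj_onD[OF bij_betw_imp_inj_on[OF bij]])
        then show False using l by simp
      qed
      ultimately show "j l < j l'" by simp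
    next
      fix l assume l: "l < k"
      have "\<phi> (u @ [l]) \<in> t" using \<phi>W' k l sub by blast
      then have "\<phi> u @ [j l] \<in> t" using plane_tree_prefix_closed[OF t _ j[OF l]] by blast
      then show "j l < k"
        using child_iff_less_outdeg[OF t, of "\<phi> u"] \<phi>W'[OF u] sub deg u by (auto simp: k_def)
    qed (use ui k in auto)
    then show ?thesis using j[of i] ui k by simp
  qed
  then have "prefix (restrict \<phi> \<tau> u @ [i]) (restrict \<phi> \<tau> (u @ [i]))" if "u @ [i] \<in> \<tau>" for u i
    using plane_tree_parent[OF \<tau> that] that by simp
  moreover have "restrict \<phi> \<tau> \<in> \<tau> \<rightarrow>\<^sub>E t" using \<phi>W' sub by auto
  ultimately show ?thesis using deg unfolding strong_embeddings_def by simp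
qed

text \<open>
  The image of \<open>\<phi>\<close> is exactly the set of non-suppressed vertices. A branching vertex of \<open>\<tau>\<close> keeps its
  children, so its image stays. A vertex of the LCA subtree outside the image lies inside a
  stretched edge, and then all selected leaves below it lie below the end of that edge; it has only one
  child in the subtree and is suppressed.
\<close>

lemma strong_embedding_imp_induces:
  assumes \<tau>: "leaf_labelled_tree \<tau> lab S" and t: "plane_tree t" and inj: "inj_on L (leaves t)"
    and \<phi>: "\<phi> \<in> strong_embeddings \<tau> t" and lab: "\<And>u. u \<in> leaves \<tau> \<Longrightarrow> L (\<phi> u) = lab u"
  shows "induces t L S \<tau> lab"
proof -
  have pl: "plane_tree \<tau>" and S: "lab ` leaves \<tau> = S"
    and bin: "\<And>u. u \<in> \<tau> - leaves \<tau> \<Longrightarrow> outdeg \<tau> u \<ge> 2"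
    using \<tau> by (auto simp: leaf_labelled_tree_def bij_betw_def)
  note child = strong_embedding_child[OF pl \<phi>]
  note pref = strong_embedding_prefix_iff[OF pl \<phi>]
  have inj\<phi>: "inj_on \<phi> \<tau>" by (rule strong_embedding_inj_on[OF pl \<phi>])
  have strict: "strict_prefix (\<phi> x) (\<phi> y) \<longleftrightarrow> strict_prefix x y" if "x \<in> \<tau>" "y \<in> \<tau>" for x y
    using pref that inj_on_eq_iff[OF inj\<phi>] by (auto simp: strict_prefix_def)
  have root: "[] \<in> \<tau>" using plane_tree_root[OF pl] .
  have leaf: "u \<in> \<tau>" "\<phi> u \<in> leaves t" if "u \<in> leaves \<tau>" for u
    using that strong_embedding_leaf[OF pl t \<phi>] by (auto simp: leaves_def)
  have deg: "outdeg t (\<phi> u) = outdeg \<tau> u" and in_t: "\<phi> u \<in> t" if "u \<in> \<tau>" for u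
    using \<phi> that by (auto simp: strong_embeddings_def)
  have A: "labelled_leaves t L S = \<phi> ` leaves \<tau>"
  proof (intro equalityI subsetI)
    fix s assume s: "s \<in> labelled_leaves t L S"
    then obtain u where u: "u \<in> leaves \<tau>" "L s = lab u" using S by (auto simp: labelled_leaves_def)
    then have "s = \<phi> u"
      using inj s leaf[OF u(1)] lab[OF u(1)] by (auto simp: labelled_leaves_def inj_on_def)
    then show "s \<in> \<phi> ` leaves \<tau>" using u by blast
  qed (use leaf lab S in \<open>auto simp: labelled_leaves_def\<close>)
  have ne: "labelled_leaves t L S \<noteq> {}"
    unfolding A using leaf_below[OF pl root] by blast
  have r: "lca t L S = \<phi> []"
    unfolding lca_def A
  proof (rule Longest_common_prefix_eq)
    show "\<phi> ` leaves \<tau> \<noteq> {}" using ne A by simp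
    show "\<forall>s\<in>\<phi> ` leaves \<tau>. prefix (\<phi> []) s" using pref[OF root] leaf by auto
    show "\<forall>qs. (\<forall>s\<in>\<phi> ` leaves \<tau>. prefix qs s) \<longrightarrow> length qs \<le> length (\<phi> [])"
    proof (intro allI impI)
      fix qs assume qs: "\<forall>s\<in>\<phi> ` leaves \<tau>. prefix qs s"
      show "length qs \<le> length (\<phi> [])"
      proof (cases "[] \<in> leaves \<tau>")
        case True
        then show ?thesis using qs by (auto dest: prefix_length_le)
      next
        case False
        then have "2 \<le> outdeg \<tau> []" using bin root by blast
        then have "[0] \<in> \<tau>" "[1] \<in> \<tau>" using child_iff_less_outdeg[OF pl root] by auto
        then obtain s0 s1 where s: "s0 \<in> leaves \<tau>" "prefix [0] s0" "s1 \<in> leaves \<tau>" "prefix [1] s1"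
          using leaf_below[OF pl] by metis
        have b: "prefix (\<phi> [] @ [0]) (\<phi> s0)" "prefix (\<phi> [] @ [1]) (\<phi> s1)"
          using child[OF leaf(1)[OF s(1)], of "[]" 0] child[OF leaf(1)[OF s(3)], of "[]" 1] s by auto
        have q: "prefix qs (\<phi> s0)" "prefix qs (\<phi> s1)" using qs s by auto
        show ?thesis
        proof (rule ccontr)
          assume "\<not> length qs \<le> length (\<phi> [])"
          then have "prefix (\<phi> [] @ [0]) qs" "prefix (\<phi> [] @ [1]) qs"
            using prefix_length_prefix[OF b(1) q(1)] prefix_length_prefix[OF b(2) q(2)] by auto
          then have "(0::nat) = 1" by (rule prefix_snoc_unique)
          then show False by simp
        qed
      qed
    qed
  qed
  define W where "W = lca_subtree t L S"
  define W' where "W' = suppress (lca t L S) W"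
  have W: "W = {u \<in> t. prefix (\<phi> []) u \<and> (\<exists>s\<in>leaves \<tau>. prefix u (\<phi> s))}"
    unfolding W_def lca_subtree_def r A by auto
  have W': "W' = {u \<in> W. u = \<phi> [] \<or> outdeg W u \<noteq> 1}"
    using suppress_lca_subtree[OF t ne] unfolding W'_def W_def r .
  have conv: "convex_nodes W" unfolding W_def by (rule convex_lca_subtree[OF t])
  have \<phi>W: "\<phi> u \<in> W" if u: "u \<in> \<tau>" for u
  proof -
    obtain s where s: "s \<in> leaves \<tau>" "prefix u s" using leaf_below[OF pl u] .
    then have "prefix (\<phi> u) (\<phi> s)" using pref[OF u leaf(1)] by blast
    then show ?thesis using s pref[OF root u] in_t[OF u] unfolding W by auto
  qed
  have in_W': "\<phi> u \<in> W'" if u: "u \<in> \<tau>" for u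
  proof -
    have "outdeg W (\<phi> u) \<noteq> 1"
    proof (cases "u \<in> leaves \<tau>")
      case True
      have "children W (\<phi> u) \<subseteq> children t (\<phi> u)"
        unfolding children_convex[OF conv \<phi>W[OF u]] children_plane_tree[OF t in_t[OF u]]
        by (auto simp: W)
      also have "\<dots> = {}" using leaf(2)[OF True] by (simp add: leaves_def)
      finally show ?thesis by (simp add: outdeg_def)
    next
      case False
      then have c: "u @ [0] \<in> \<tau>" "u @ [1] \<in> \<tau>"
        using bin[of u] u child_iff_less_outdeg[OF pl u] by auto
      have "\<phi> u @ [i] \<in> children W (\<phi> u)" if "u @ [i] \<in> \<tau>" for i
      proof -
        have "prefix (\<phi> u @ [i]) (\<phi> (u @ [i]))" by (rule child[OF that]) simp
        moreover have "prefix (\<phi> u) (\<phi> u @ [i])" by simp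
        ultimately have "\<phi> u @ [i] \<in> W"
          using convex_nodesD[OF conv \<phi>W[OF u] \<phi>W[OF that]] by blast
        then show ?thesis using children_convex[OF conv \<phi>W[OF u]] by simp
      qed
      from this[OF c(1)] this[OF c(2)] show ?thesis by (rule outdeg_neq_1) simp
    qed
    then show ?thesis using \<phi>W[OF u] by (simp add: W')
  qed
  \<comment> \<open>Walking from the root of \<open>\<tau>\<close> to a leaf whose image is below \<open>w\<close> finds the edge from \<open>u\<close>
    to \<open>u @ [i]\<close> whose stretched path contains \<open>w\<close> in its interior.\<close>
  have onto: "w \<in> \<phi> ` \<tau>" if w: "w \<in> W'" for w
  proof (rule ccontr)
    assume w_new: "w \<notin> \<phi> ` \<tau>"
    have wW: "w \<in> W" and w1: "outdeg W w \<noteq> 1" using w w_new root by (auto simp: W')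
    then obtain s where s: "s \<in> leaves \<tau>" "prefix w (\<phi> s)" and w0: "prefix (\<phi> []) w"
      by (auto simp: W)
    have s\<tau>: "s \<in> \<tau>" using leaf s by blast
    have "\<exists>u i. prefix (u @ [i]) x \<and> prefix (\<phi> u) w \<and> \<not> prefix (\<phi> (u @ [i])) w"
      if "x \<in> \<tau>" "\<not> prefix (\<phi> x) w" for x
      using that
    proof (induction x rule: rev_induct)
      case Nil
      then show ?case using w0 by simp
    next
      case (snoc i x)
      show ?case
      proof (cases "prefix (\<phi> x) w")
        case True
        then show ?thesis using snoc.prems by blast
      next
        case False
        then show ?thesis
          using snoc.IH plane_tree_parent[OF pl snoc.prems(1)] by (metis prefix_prefix)
      qed
    qed
    moreover have "\<not> prefix (\<phi> s) w"
      using s w_new s\<tau> by (metis imageI prefix_order.order_antisym)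
    ultimately obtain u i where ui: "prefix (u @ [i]) s" "prefix (\<phi> u) w" "\<not> prefix (\<phi> (u @ [i])) w"
      using s\<tau> by blast
    have ui\<tau>: "u @ [i] \<in> \<tau>" using plane_tree_prefix_closed[OF pl s\<tau> ui(1)] .
    have u\<tau>: "u \<in> \<tau>" using plane_tree_parent[OF pl ui\<tau>] .
    have "prefix w (\<phi> (u @ [i]))"
      using prefix_same_cases[OF s(2)] pref[OF ui\<tau> s\<tau>] ui(1,3) by blast
    then have below: "strict_prefix w (\<phi> (u @ [i]))" using ui(3) by (auto simp: strict_prefix_def)
    have above: "strict_prefix (\<phi> u) w" using ui(2) w_new u\<tau> by (auto simp: strict_prefix_def)
    obtain c where c: "prefix (w @ [c]) (\<phi> (u @ [i]))" using strict_prefix_snocE[OF below] .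
    have "children W w = {w @ [c]}"
    proof (intro equalityI subsetI)
      fix x assume "x \<in> children W w"
      then obtain d where d: "x = w @ [d]" "x \<in> W" using children_convex[OF conv wW] by auto
      then obtain s' where s': "s' \<in> leaves \<tau>" "prefix (w @ [d]) (\<phi> s')" by (auto simp: W)
      have s'\<tau>: "s' \<in> \<tau>" using leaf s' by blast
      have "strict_prefix (\<phi> u) (\<phi> s')"
        using above s'(2) by (meson append_prefixD prefix_order.less_le_trans)
      then have "strict_prefix u s'" using strict u\<tau> s'\<tau> by blast
      then obtain j where j: "prefix (u @ [j]) s'" by (rule strict_prefix_snocE)
      obtain l where l: "prefix (\<phi> u @ [l]) w" using strict_prefix_snocE[OF above] .
      have "prefix (\<phi> u @ [j]) (\<phi> s')" by (rule child[OF s'\<tau> j])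
      moreover have "prefix (\<phi> u @ [l]) (\<phi> s')"
        using l s'(2) by (meson append_prefixD prefix_order.trans)
      moreover have "prefix (\<phi> u @ [i]) (\<phi> (u @ [i]))" by (rule child[OF ui\<tau>]) simp
      moreover have "prefix (\<phi> u @ [l]) (\<phi> (u @ [i]))"
        using l below by (meson prefix_order.trans strict_prefix_def)
      ultimately have "j = i" using prefix_snoc_unique by metis
      then have "prefix (\<phi> (u @ [i])) (\<phi> s')" using pref[OF ui\<tau> s'\<tau>] j by simp
      then have "prefix (w @ [c]) (\<phi> s')" using c by (meson prefix_order.trans)
      then have "c = d" using s'(2) by (rule prefix_snoc_unique)
      then show "x \<in> {w @ [c]}" using d by simp
    next
      fix x assume "x \<in> {w @ [c]}"
      moreover have "w @ [c] \<in> W"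
        by (rule convex_nodesD[OF conv wW \<phi>W[OF ui\<tau>] _ c]) simp
      ultimately show "x \<in> children W w" using children_convex[OF conv wW] by auto
    qed
    then show False using w1 by (simp add: outdeg_def)
  qed
  have img: "\<phi> ` \<tau> = W'" using in_W' onto by blast
  have ch: "w \<in> children \<tau> u \<longleftrightarrow> \<phi> w \<in> children W' (\<phi> u)" if "u \<in> \<tau>" "w \<in> \<tau>" for u w
  proof -
    have "(\<exists>z\<in>W'. strict_prefix (\<phi> u) z \<and> strict_prefix z (\<phi> w))
        \<longleftrightarrow> (\<exists>z\<in>\<tau>. strict_prefix u z \<and> strict_prefix z w)"
      unfolding img[symmetric] using strict that by auto
    then show ?thesis
      unfolding children_def using that strict in_W' by auto
  qed
  have lex: "(\<phi> w, \<phi> z) \<in> lexord less_than"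
    if u: "u \<in> \<tau>" and w: "w \<in> children \<tau> u" and z: "z \<in> children \<tau> u"
      and wz: "(w, z) \<in> lexord less_than" for u w z
  proof -
    obtain i j where ij: "w = u @ [i]" "z = u @ [j]" "w \<in> \<tau>" "z \<in> \<tau>"
      using w z children_plane_tree[OF pl u] by auto
    have "i < j" using wz by (simp add: ij lexord_same_pref_iff)
    moreover have "prefix (\<phi> u @ [i]) (\<phi> w)" by (rule child[OF ij(3)]) (simp add: ij)
    moreover have "prefix (\<phi> u @ [j]) (\<phi> z)" by (rule child[OF ij(4)]) (simp add: ij)
    ultimately show ?thesis using lexord_branch by blast
  qed
  have "labelled_tree_iso \<phi> [] \<tau> lab (lca t L S) W' L"
    unfolding labelled_tree_iso_def
    using inj\<phi> img r ch lex lab by (auto simp: bij_betw_def)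
  then show ?thesis
    unfolding induces_def W'_def W_def using deg by blast
qed

text \<open>
  Injectivity of the labelling on the leaves serves to identify the leaves with labels in \<open>S\<close> as the images of
  the leaves of \<open>\<tau>\<close>.
\<close>

lemma induces_iff_strong_embedding:
  assumes \<tau>: "leaf_labelled_tree \<tau> lab S" and t: "plane_tree t" and inj: "inj_on L (leaves t)"
    and S: "S \<noteq> {}" "S \<subseteq> L ` leaves t"
  shows "induces t L S \<tau> lab \<longleftrightarrow> (\<exists>\<phi>\<in>strong_embeddings \<tau> t. \<forall>u\<in>leaves \<tau>. L (\<phi> u) = lab u)"
proof
  assume "induces t L S \<tau> lab"
  then obtain \<phi> where iso: "labelled_tree_iso \<phi> [] \<tau> lab
             (lca t L S) (suppress (lca t L S) (lca_subtree t L S)) L"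
    and deg: "\<forall>u\<in>\<tau>. outdeg t (\<phi> u) = outdeg \<tau> u" unfolding induces_def by blast
  have "labelled_leaves t L S \<noteq> {}" using S by (auto simp: labelled_leaves_def)
  moreover have "plane_tree \<tau>" using \<tau> by (simp add: leaf_labelled_tree_def)
  ultimately have "restrict \<phi> \<tau> \<in> strong_embeddings \<tau> t"
    using induces_imp_strong_embedding[OF _ t _ iso deg] by blast
  moreover have "\<forall>u\<in>leaves \<tau>. L (restrict \<phi> \<tau> u) = lab u"
    using iso by (simp add: labelled_tree_iso_def leaves_def)
  ultimately show "\<exists>\<phi>\<in>strong_embeddings \<tau> t. \<forall>u\<in>leaves \<tau>. L (\<phi> u) = lab u" by blast
qed (use strong_embedding_imp_induces[OF \<tau> t inj] in blast)

section \<open>Generating functions of trees without unary vertices\<close>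

text \<open>
  Trees with a vertex of out-degree 1 have probability 0 when \<open>p\<^sub>1 = 0\<close>. Leaving them out makes the number
  of trees with \<open>n\<close> leaves finite.
\<close>

definition reduced_trees :: "nat \<Rightarrow> nat list set set" where
  "reduced_trees n = {t. plane_tree t \<and> (\<forall>u\<in>t. outdeg t u \<noteq> 1) \<and> card (leaves t) = n}"

definition reduced_forests :: "nat \<Rightarrow> nat \<Rightarrow> nat list set list set" where
  "reduced_forests j n = {ts. length ts = j \<and> (\<forall>s\<in>set ts. s \<in> reduced_trees (card (leaves s))) \<and>
     (\<Sum>s\<leftarrow>ts. card (leaves s)) = n}"

lemma reduced_treesD: "t \<in> reduced_trees n \<Longrightarrow> plane_tree t"
  by (simp add: reduced_trees_def)

lemma reduced_forests_plane: "ts \<in> reduced_forests j n \<Longrightarrow> \<forall>s\<in>set ts. plane_tree s"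
  unfolding reduced_forests_def by (blast dest: reduced_treesD)

lemma reduced_forests_length: "ts \<in> reduced_forests j n \<Longrightarrow> length ts = j"
  by (simp add: reduced_forests_def)

lemma reduced_trees_0 [simp]: "reduced_trees 0 = {}"
proof -
  have "card (leaves t) \<noteq> 0" if "plane_tree t" for t using card_leaves_pos[OF that] by simp
  then show ?thesis unfolding reduced_trees_def by blast
qed

lemma card_leaves_graft_list:
  assumes "\<forall>s\<in>set ts. plane_tree s"
  shows "card (leaves (graft ts)) = (if ts = [] then 1 else (\<Sum>s\<leftarrow>ts. card (leaves s)))"
  using card_leaves_graft[of ts, OF assms]
  by (simp add: sum_list_sum_nth atLeast0LessThan)

lemma length_le_leaves:
  assumes "\<forall>s\<in>set ts. plane_tree s"
  shows "length ts \<le> (\<Sum>s\<leftarrow>ts. card (leaves s))"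
  using assms
proof (induction ts)
  case (Cons s ts)
  have "0 < card (leaves s)" using Cons.prems by (intro card_leaves_pos) simp
  then show ?case using Cons by simp
qed simp

lemma graft_in_reduced_trees_iff:
  assumes ts: "\<forall>s\<in>set ts. plane_tree s"
  shows "graft ts \<in> reduced_trees n \<longleftrightarrow>
    (ts = [] \<and> n = 1) \<or> (2 \<le> length ts \<and> length ts \<le> n \<and> ts \<in> reduced_forests (length ts) n)"
proof -
  have "(\<forall>u\<in>graft ts. outdeg (graft ts) u \<noteq> 1) \<longleftrightarrow>
      length ts \<noteq> 1 \<and> (\<forall>i<length ts. \<forall>u\<in>ts ! i. outdeg (ts ! i) u \<noteq> 1)"
    using outdeg_graft_Nil[OF ts] outdeg_graft_Cons[OF ts] by (auto simp: graft_def)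
  then have "graft ts \<in> reduced_trees n \<longleftrightarrow>
      length ts \<noteq> 1 \<and> (\<forall>s\<in>set ts. s \<in> reduced_trees (card (leaves s))) \<and>
      n = (if ts = [] then 1 else (\<Sum>s\<leftarrow>ts. card (leaves s)))"
    using plane_tree_graft[OF ts] card_leaves_graft_list[OF ts] ts
    by (auto simp: reduced_trees_def all_set_conv_all_nth)
  moreover have "length ts \<noteq> 1 \<longleftrightarrow> ts = [] \<or> 2 \<le> length ts"
    using length_0_conv[of ts] by linarith
  moreover have "length ts \<le> (\<Sum>s\<leftarrow>ts. card (leaves s))" by (rule length_le_leaves[OF ts])
  ultimately show ?thesis by (cases "ts = []") (auto simp: reduced_forests_def)
qed

text \<open>
  With at least two branches, each with at least one leaf, every branch has fewer leaves than the whole tree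
  and there are at most \<open>n\<close> branches. Finiteness and the recursion for the coefficients both rest on this.
\<close>

lemma reduced_trees_eq:
  "reduced_trees n = graft ` ((if n = 1 then {[]} else {}) \<union> (\<Union>j\<in>{2..n}. reduced_forests j n))"
  (is "_ = graft ` ?F")
proof -
  have F: "ts \<in> ?F \<longleftrightarrow> (ts = [] \<and> n = 1) \<or>
      (2 \<le> length ts \<and> length ts \<le> n \<and> ts \<in> reduced_forests (length ts) n)" for ts
    by (auto simp: reduced_forests_def)
  have plane: "\<forall>s\<in>set ts. plane_tree s" if "ts \<in> ?F" for ts
    using that reduced_forests_plane[of ts "length ts" n] unfolding F by auto
  show ?thesis
  proof (intro equalityI subsetI)
    fix t assume t: "t \<in> reduced_trees n"
    obtain ts where ts: "t = graft ts" and pl: "\<forall>s\<in>set ts. plane_tree s"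
      using plane_tree_is_graft[OF reduced_treesD[OF t]] by blast
    have "ts \<in> ?F" unfolding F using t ts graft_in_reduced_trees_iff[OF pl, of n] by simp
    then show "t \<in> graft ` ?F" using ts by simp
  next
    fix t assume "t \<in> graft ` ?F"
    then obtain ts where ts: "t = graft ts" "ts \<in> ?F" by blast
    have "graft ts \<in> reduced_trees n"
      using graft_in_reduced_trees_iff[OF plane[OF ts(2)], of n] ts(2) unfolding F by simp
    then show "t \<in> reduced_trees n" using ts(1) by simp
  qed
qed

lemma finite_reduced_trees [simp]: "finite (reduced_trees n)"
proof (induction n rule: less_induct)
  case (less n)
  have "finite (reduced_forests j n)" if j: "2 \<le> j" for j
  proof (rule finite_subset)
    show "reduced_forests j n \<subseteq> {ts. set ts \<subseteq> (\<Union>m<n. reduced_trees m) \<and> length ts = j}"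
    proof (intro subsetI CollectI conjI)
      fix ts s assume ts: "ts \<in> reduced_forests j n" and s: "s \<in> set ts"
      obtain xs ys where split: "ts = xs @ s # ys" using s by (meson split_list)
      have pl: "\<forall>s\<in>set ts. plane_tree s" using reduced_forests_plane[OF ts] .
      have "length xs + length ys \<ge> 1" using ts j split by (auto simp: reduced_forests_def)
      moreover have "length xs \<le> (\<Sum>s\<leftarrow>xs. card (leaves s))"
        "length ys \<le> (\<Sum>s\<leftarrow>ys. card (leaves s))"
        using pl split by (auto intro!: length_le_leaves)
      ultimately have "card (leaves s) < n" using ts split by (auto simp: reduced_forests_def)
      moreover have "s \<in> reduced_trees (card (leaves s))"
        using ts s by (simp add: reduced_forests_def)
      ultimately show "s \<in> (\<Union>m<n. reduced_trees m)" by blast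
    next
      fix ts assume "ts \<in> reduced_forests j n" then show "length ts = j" by (simp add: reduced_forests_def)
    qed
    show "finite {ts. set ts \<subseteq> (\<Union>m<n. reduced_trees m) \<and> length ts = j}"
      by (rule finite_lists_length_eq) (use less in auto)
  qed
  then show ?case unfolding reduced_trees_eq by auto
qed

lemma finite_reduced_forests [simp]: "finite (reduced_forests j n)"
proof (rule finite_subset)
  show "reduced_forests j n \<subseteq> {ts. set ts \<subseteq> (\<Union>m\<le>n. reduced_trees m) \<and> length ts = j}"
  proof (intro subsetI CollectI conjI)
    fix ts s assume ts: "ts \<in> reduced_forests j n" and s: "s \<in> set ts"
    have "card (leaves s) \<le> (\<Sum>s\<leftarrow>ts. card (leaves s))"
      using s by (intro member_le_sum_list) auto
    then have "card (leaves s) \<le> n" and "s \<in> reduced_trees (card (leaves s))"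
      using ts s by (simp_all add: reduced_forests_def)
    then show "s \<in> (\<Union>m\<le>n. reduced_trees m)" by blast
  next
    fix ts assume "ts \<in> reduced_forests j n" then show "length ts = j" by (simp add: reduced_forests_def)
  qed
qed (rule finite_lists_length_eq, simp)

definition tree_gf :: "(nat list set \<Rightarrow> real) \<Rightarrow> real fps" where
  "tree_gf h = Abs_fps (\<lambda>n. \<Sum>t\<in>reduced_trees n. h t)"

lemma tree_gf_0 [simp]: "fps_nth (tree_gf h) 0 = 0"
  by (simp add: tree_gf_def)

lemma reduced_forests_0: "reduced_forests 0 n = (if n = 0 then {[]} else {})"
  by (auto simp: reduced_forests_def)

lemma reduced_forests_Suc:
  "bij_betw (\<lambda>(i, t, ts). t # ts)
     (SIGMA i:{0..n}. reduced_trees i \<times> reduced_forests j (n - i)) (reduced_forests (Suc j) n)"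
proof (rule bij_betwI')
  fix x y assume "x \<in> (SIGMA i:{0..n}. reduced_trees i \<times> reduced_forests j (n - i))"
    "y \<in> (SIGMA i:{0..n}. reduced_trees i \<times> reduced_forests j (n - i))"
  then show "((\<lambda>(i, t, ts). t # ts) x = (\<lambda>(i, t, ts). t # ts) y) = (x = y)"
    by (auto simp: reduced_trees_def)
next
  fix x assume "x \<in> (SIGMA i:{0..n}. reduced_trees i \<times> reduced_forests j (n - i))"
  then show "(\<lambda>(i, t, ts). t # ts) x \<in> reduced_forests (Suc j) n"
    by (auto simp: reduced_forests_def reduced_trees_def)
next
  fix ts' assume ts': "ts' \<in> reduced_forests (Suc j) n"
  then obtain t ts where "ts' = t # ts" by (auto simp: reduced_forests_def length_Suc_conv)
  then have "(card (leaves t), t, ts) \<in> (SIGMA i:{0..n}. reduced_trees i \<times> reduced_forests j (n - i))"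
    using ts' by (auto simp: reduced_forests_def)
  then show "\<exists>x\<in>(SIGMA i:{0..n}. reduced_trees i \<times> reduced_forests j (n - i)). ts' = (\<lambda>(i, t, ts). t # ts) x"
    using \<open>ts' = t # ts\<close> by (intro bexI) auto
qed

text \<open>
  Products of series enumerate ordered forests.
\<close>

lemma prod_tree_gf_nth:
  "fps_nth (\<Prod>i<j. tree_gf (h i)) n = (\<Sum>ts\<in>reduced_forests j n. \<Prod>i<j. h i (ts ! i))"
proof (induction j arbitrary: h n)
  case 0
  then show ?case by (simp add: reduced_forests_0)
next
  case (Suc j)
  have "fps_nth (\<Prod>i<Suc j. tree_gf (h i)) n =
      (\<Sum>i=0..n. fps_nth (tree_gf (h 0)) i * fps_nth (\<Prod>i<j. tree_gf (h (Suc i))) (n - i))"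
    by (simp add: prod.lessThan_Suc_shift fps_mult_nth del: prod.lessThan_Suc)
  also have "\<dots> = (\<Sum>i=0..n. \<Sum>(t, ts)\<in>reduced_trees i \<times> reduced_forests j (n - i).
      h 0 t * (\<Prod>i<j. h (Suc i) (ts ! i)))"
    unfolding Suc.IH by (simp add: tree_gf_def sum_product sum.cartesian_product)
  also have "\<dots> = (\<Sum>(i, t, ts)\<in>(SIGMA i:{0..n}. reduced_trees i \<times> reduced_forests j (n - i)).
      h 0 t * (\<Prod>i<j. h (Suc i) (ts ! i)))"
    by (subst sum.Sigma) (auto simp: case_prod_beta)
  also have "\<dots> = (\<Sum>x\<in>(SIGMA i:{0..n}. reduced_trees i \<times> reduced_forests j (n - i)).
      (\<lambda>ts. \<Prod>i<Suc j. h i (ts ! i)) ((\<lambda>(i, t, ts). t # ts) x))"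
    by (intro sum.cong refl) (auto simp: prod.lessThan_Suc_shift simp del: prod.lessThan_Suc)
  also have "\<dots> = (\<Sum>ts\<in>reduced_forests (Suc j) n. \<Prod>i<Suc j. h i (ts ! i))"
    by (rule sum.reindex_bij_betw[OF reduced_forests_Suc])
  finally show ?case .
qed

text \<open>
  The recursion for the coefficients of any statistic in which the root contributes a factor that depends
  only on its out-degree.
\<close>

lemma tree_gf_nth_graft:
  assumes h: "\<And>ts. \<forall>s\<in>set ts. plane_tree s \<Longrightarrow> h (graft ts) = q (length ts) * g ts"
  shows "fps_nth (tree_gf h) n =
    (if n = 1 then q 0 * g [] else 0) + (\<Sum>j=2..n. q j * (\<Sum>ts\<in>reduced_forests j n. g ts))"
proof -
  let ?F = "\<Union>j\<in>{2..n}. reduced_forests j n" and ?L = "if n = 1 then {[]} else {}"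
  have plane: "\<forall>s\<in>set ts. plane_tree s" if "ts \<in> ?L \<union> ?F" for ts
    using that by (auto dest!: reduced_forests_plane split: if_splits)
  have inj: "inj_on graft (?L \<union> ?F)"
    by (rule inj_onI) (use plane graft_inject in blast)
  have "fps_nth (tree_gf h) n = (\<Sum>ts\<in>?L \<union> ?F. h (graft ts))"
    unfolding tree_gf_def fps_nth_Abs_fps reduced_trees_eq
    by (subst sum.reindex[OF inj]) simp
  also have "\<dots> = (\<Sum>ts\<in>?L \<union> ?F. q (length ts) * g ts)"
    by (intro sum.cong refl h) (use plane in blast)
  also have "\<dots> = (\<Sum>ts\<in>?L. q (length ts) * g ts) + (\<Sum>ts\<in>?F. q (length ts) * g ts)"
    by (rule sum.union_disjoint) (auto dest: reduced_forests_length split: if_splits)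
  also have "(\<Sum>ts\<in>?F. q (length ts) * g ts) = (\<Sum>j=2..n. \<Sum>ts\<in>reduced_forests j n. q (length ts) * g ts)"
    by (rule sum.UNION_disjoint) (auto dest!: reduced_forests_length)
  also have "\<dots> = (\<Sum>j=2..n. q j * (\<Sum>ts\<in>reduced_forests j n. g ts))"
    unfolding sum_distrib_left by (intro sum.cong refl) (auto simp: reduced_forests_def)
  finally show ?thesis by simp
qed

section \<open>The leaf generating function\<close>

lemma sum_split_0_1:
  fixes f :: "nat \<Rightarrow> real"
  shows "(\<Sum>i=0..n. f i) = f 0 + (if 1 \<le> n then f 1 else 0) + (\<Sum>i=2..n. f i)"
proof (cases "n = 0")
  case False
  then have "(\<Sum>i=0..n. f i) = f 0 + (f 1 + (\<Sum>i=2..n. f i))"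
    by (simp add: sum.atLeast_Suc_atMost numeral_2_eq_2)
  then show ?thesis using False by simp
qed simp

abbreviation reduced_gf :: "nat pmf \<Rightarrow> real fps" where
  "reduced_gf p \<equiv> tree_gf (tree_prob p)"

lemma reduced_gf_power_nth:
  "fps_nth (reduced_gf p ^ j) n = (\<Sum>ts\<in>reduced_forests j n. \<Prod>i<j. tree_prob p (ts ! i))"
  using prod_tree_gf_nth[of "\<lambda>_. tree_prob p" j n] by simp

lemma leaf_gf_rhs_nth:
  assumes p1: "pmf p 1 = 0"
  shows "fps_nth (fps_compose (offspring_fps p) h + fps_const (pmf p 0) * (fps_X - 1)) n =
    (if n = 1 then pmf p 0 else 0) + (\<Sum>j=2..n. pmf p j * fps_nth (h ^ j) n)"
proof -
  have "fps_nth (fps_compose (offspring_fps p) h + fps_const (pmf p 0) * (fps_X - 1)) n =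
      (\<Sum>j=0..n. pmf p j * fps_nth (h ^ j) n) + (if n = 1 then pmf p 0 else 0) - (if n = 0 then pmf p 0 else 0)"
    by (simp add: fps_compose_nth offspring_fps_def fps_X_def)
  also have "(\<Sum>j=0..n. pmf p j * fps_nth (h ^ j) n) =
      (if n = 0 then pmf p 0 else 0) + (\<Sum>j=2..n. pmf p j * fps_nth (h ^ j) n)"
    unfolding sum_split_0_1 using p1 by simp
  finally show ?thesis by linarith
qed

lemma leaf_gf_reduced_gf:
  assumes p1: "pmf p 1 = 0"
  shows "leaf_gf p (reduced_gf p)"
proof -
  define g where "g ts = (\<Prod>i<length ts. tree_prob p (ts ! i))" for ts
  have "fps_nth (reduced_gf p) n =
      fps_nth (fps_compose (offspring_fps p) (reduced_gf p) + fps_const (pmf p 0) * (fps_X - 1)) n" for n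
  proof -
    have "fps_nth (reduced_gf p) n = (if n = 1 then pmf p 0 * g [] else 0)
        + (\<Sum>j=2..n. pmf p j * (\<Sum>ts\<in>reduced_forests j n. g ts))"
      by (rule tree_gf_nth_graft) (simp add: g_def tree_prob_graft)
    also have "g [] = 1" by (simp add: g_def)
    also have "(\<Sum>j=2..n. pmf p j * (\<Sum>ts\<in>reduced_forests j n. g ts))
        = (\<Sum>j=2..n. pmf p j * fps_nth (reduced_gf p ^ j) n)"
      unfolding reduced_gf_power_nth g_def
      by (intro sum.cong refl arg_cong2[where f = "(*)"]) (auto dest: reduced_forests_length)
    finally show ?thesis unfolding leaf_gf_rhs_nth[OF p1] by simp
  qed
  then show ?thesis unfolding leaf_gf_def by (simp add: fps_eq_iff)
qed

lemma fps_power_nth_cong: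
  fixes f g :: "real fps"
  assumes "\<And>m. m < n \<Longrightarrow> fps_nth f m = fps_nth g m" "m < n"
  shows "fps_nth (f ^ j) m = fps_nth (g ^ j) m"
  using assms(2)
proof (induction j arbitrary: m)
  case (Suc j)
  then show ?case using assms(1) by (auto simp: fps_mult_nth intro!: sum.cong)
qed simp

lemma leaf_gf_eq:
  "leaf_gf p f \<Longrightarrow> f = fps_compose (offspring_fps p) f + fps_const (pmf p 0) * (fps_X - 1)"
  by (simp only: leaf_gf_def)

text \<open>
  Because \<open>p\<^sub>1 = 0\<close> and the constant term vanishes, the coefficient of degree \<open>n\<close> is determined by those of
  smaller degree.
\<close>

lemma leaf_gf_unique:
  assumes p1: "pmf p 1 = 0" and f: "leaf_gf p f" and g: "leaf_gf p g"
  shows "f = g"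
proof -
  have f0: "fps_nth f 0 = 0" and g0: "fps_nth g 0 = 0" using f g by (auto simp: leaf_gf_def)
  have coeff: "fps_nth h n = (if n = 1 then pmf p 0 else 0) + (\<Sum>j=2..n. pmf p j * fps_nth (h ^ j) n)"
    if "leaf_gf p h" for h n
    unfolding leaf_gf_rhs_nth[OF p1, symmetric]
    by (rule arg_cong[OF leaf_gf_eq[OF that], of "\<lambda>F. fps_nth F n"])
  have "fps_nth f n = fps_nth g n" for n
  proof (induction n rule: less_induct)
    case (less n)
    have "fps_nth (f ^ j) n = fps_nth (g ^ j) n" if "2 \<le> j" for j
    proof -
      obtain i where i: "j = Suc (Suc i)" using \<open>2 \<le> j\<close> by (metis add_2_eq_Suc le_Suc_ex)
      have "fps_nth (f * f ^ Suc i) n = fps_nth (g * g ^ Suc i) n"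
        unfolding fps_mult_nth
      proof (rule sum.cong[OF refl])
        fix k assume k: "k \<in> {0..n}"
        show "fps_nth f k * fps_nth (f ^ Suc i) (n - k) = fps_nth g k * fps_nth (g ^ Suc i) (n - k)"
        proof (cases "k = 0 \<or> k = n")
          case True
          then show ?thesis using f0 g0 by (auto simp: fps_mult_nth)
        next
          case False
          then have "fps_nth (f ^ Suc i) (n - k) = fps_nth (g ^ Suc i) (n - k)"
            using k less by (intro fps_power_nth_cong[where n = n]) auto
          then show ?thesis using less[of k] False k by simp
        qed
      qed
      then show ?thesis by (simp add: i)
    qed
    then have "(\<Sum>j=2..n. pmf p j * fps_nth (f ^ j) n) = (\<Sum>j=2..n. pmf p j * fps_nth (g ^ j) n)"
      by (intro sum.cong refl) simp
    then show ?case unfolding coeff[OF f, of n] coeff[OF g, of n] by (simp only:)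
  qed
  then show ?thesis by (simp add: fps_eq_iff)
qed

section \<open>The generating function of strong embeddings\<close>

text \<open>
  The powers of \<open>f\<close> beyond the \<open>n\<close>-th do not reach degree \<open>n\<close>, so the composition may be
  truncated at the same place for every coefficient.
\<close>

lemma fps_compose_mult_nth:
  fixes a f g :: "real fps"
  assumes f0: "fps_nth f 0 = 0"
  shows "fps_nth (fps_compose a f * g) n = (\<Sum>k=0..n. fps_nth a k * fps_nth (f ^ k * g) n)"
proof -
  have "fps_nth (fps_compose a f * g) n =
      (\<Sum>i=0..n. (\<Sum>k=0..n. fps_nth a k * fps_nth (f ^ k) i) * fps_nth g (n - i))"
    unfolding fps_mult_nth fps_compose_nth
  proof (rule sum.cong[OF refl])
    fix i assume "i \<in> {0..n}"
    then have "(\<Sum>k=0..i. fps_nth a k * fps_nth (f ^ k) i) = (\<Sum>k=0..n. fps_nth a k * fps_nth (f ^ k) i)"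
      using startsby_zero_power_prefix[OF f0] by (intro sum.mono_neutral_left) auto
    then show "(\<Sum>k=0..i. fps_nth a k * fps_nth (f ^ k) i) * fps_nth g (n - i) =
        (\<Sum>k=0..n. fps_nth a k * fps_nth (f ^ k) i) * fps_nth g (n - i)" by simp
  qed
  also have "\<dots> = (\<Sum>i=0..n. \<Sum>k=0..n. fps_nth a k * (fps_nth (f ^ k) i * fps_nth g (n - i)))"
    by (simp add: sum_distrib_right mult.assoc)
  also have "\<dots> = (\<Sum>k=0..n. \<Sum>i=0..n. fps_nth a k * (fps_nth (f ^ k) i * fps_nth g (n - i)))"
    by (rule sum.swap)
  finally show ?thesis by (simp add: fps_mult_nth sum_distrib_left)
qed

text \<open>
  The sum stops at \<open>j = n\<close>, in line with the recursion for trees with \<open>n\<close> leaves: as \<open>g\<close> has no constant term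
  either, \<open>f ^ n * g\<close> has no term of degree \<open>n\<close>.
\<close>

lemma Phi1_mult_nth:
  assumes f0: "fps_nth f 0 = 0" and g0: "fps_nth g 0 = 0"
  shows "fps_nth (Phi1 p f * g) n = (\<Sum>j=2..n. real j * pmf p j * fps_nth (f ^ (j - 1) * g) n)"
proof -
  define a where "a k = (if k \<ge> 1 then real (k + 1) * pmf p (k + 1) else 0)" for k
  have last: "fps_nth (f ^ n * g) n = 0"
    unfolding fps_mult_nth
  proof (intro sum.neutral ballI)
    fix i assume "i \<in> {0..n}"
    then show "fps_nth (f ^ n) i * fps_nth g (n - i) = 0"
      using startsby_zero_power_prefix[OF f0, of n] g0 by (cases "i = n") auto
  qed
  have "fps_nth (Phi1 p f * g) n = (\<Sum>k=0..n. a k * fps_nth (f ^ k * g) n)"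
    unfolding Phi1_def fps_compose_mult_nth[OF f0] by (simp add: a_def)
  also have "\<dots> = (\<Sum>k\<in>{1..<n}. a k * fps_nth (f ^ k * g) n)"
    by (rule sum.mono_neutral_right) (use last in \<open>auto simp: a_def not_less\<close>)
  also have "\<dots> = (\<Sum>j\<in>{2..n}. real j * pmf p j * fps_nth (f ^ (j - 1) * g) n)"
    by (rule sum.reindex_bij_witness[of _ "\<lambda>j. j - 1" Suc]) (auto simp: a_def)
  finally show ?thesis .
qed

definition embedding_gf :: "nat pmf \<Rightarrow> nat list set \<Rightarrow> real fps" where
  "embedding_gf p \<tau> = tree_gf (\<lambda>t. tree_prob p t * real (card (strong_embeddings \<tau> t)))"

lemma prod_replace_one:
  fixes a b :: "'b::comm_monoid_mult"
  assumes "i < j"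
  shows "(\<Prod>l<j. if l = i then a else b) = a * b ^ (j - 1)"
proof -
  have "(\<Prod>l<j. if l = i then a else b) = a * (\<Prod>l\<in>{..<j} - {i}. if l = i then a else b)"
    using assms by (subst prod.remove[of _ i]) auto
  also have "(\<Prod>l\<in>{..<j} - {i}. if l = i then a else b) = (\<Prod>l\<in>{..<j} - {i}. b)"
    by (rule prod.cong) auto
  finally show ?thesis using assms by (simp add: prod_constant)
qed

text \<open>
  The two cases of the count of strong embeddings become the two terms of a linear equation for the series:
  root on root gives the product of the branch series, and the choice of one of \<open>j\<close> branches gives
  \<open>j p\<^sub>j \<Phi>^(j-1)\<close> times the series itself.
\<close>

lemma embedding_gf_graft:
  assumes p1: "pmf p 1 = 0" and ss: "\<forall>s\<in>set ss. plane_tree s"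
  defines "\<Phi> \<equiv> reduced_gf p"
  shows "(1 - Phi1 p \<Phi>) * embedding_gf p (graft ss) =
    fps_const (pmf p (length ss)) * (if ss = [] then fps_X else \<Prod>i<length ss. embedding_gf p (ss ! i))"
proof -
  let ?k = "length ss"
  let ?G = "embedding_gf p (graft ss)"
  let ?w = "tree_prob p"
  define c where "c \<sigma> t = real (card (strong_embeddings \<sigma> t))" for \<sigma> t
  define g where "g ts = (\<Prod>i<length ts. ?w (ts ! i)) *
    ((if ?k = length ts then \<Prod>i<?k. c (ss ! i) (ts ! i) else 0) + (\<Sum>i<length ts. c (graft ss) (ts ! i)))" for ts
  have h: "?w (graft ts) * c (graft ss) (graft ts) = pmf p (length ts) * g ts"
    if "\<forall>s\<in>set ts. plane_tree s" for ts
    unfolding g_def c_def tree_prob_graft[OF that] card_strong_embeddings_graft[OF ss that]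
    by simp
  \<comment> \<open>Marking branch \<open>i\<close> by a strong embedding replaces one of the \<open>j\<close> factors \<open>\<Phi>\<close> by the
    series of \<open>\<tau>\<close>, whatever \<open>i\<close> is.\<close>
  have sum_g: "(\<Sum>ts\<in>reduced_forests j n. g ts) =
      (if ?k = j then fps_nth (\<Prod>i<?k. embedding_gf p (ss ! i)) n else 0)
      + real j * fps_nth (\<Phi> ^ (j - 1) * ?G) n" for j n
  proof -
    have "(\<Sum>ts\<in>reduced_forests j n. g ts) = (\<Sum>ts\<in>reduced_forests j n.
        (if ?k = j then \<Prod>i<j. ?w (ts ! i) * c (ss ! i) (ts ! i) else 0)
        + (\<Sum>i<j. \<Prod>l<j. (if l = i then \<lambda>t. ?w t * c (graft ss) t else ?w) (ts ! l)))"
    proof (rule sum.cong[OF refl])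
      fix ts assume "ts \<in> reduced_forests j n"
      then have len: "length ts = j" by (simp add: reduced_forests_def)
      have "(\<Prod>l<j. (if l = i then \<lambda>t. ?w t * c (graft ss) t else ?w) (ts ! l)) =
          (\<Prod>l<j. ?w (ts ! l)) * c (graft ss) (ts ! i)" if i: "i < j" for i
      proof -
        have "(\<Prod>l<j. (if l = i then \<lambda>t. ?w t * c (graft ss) t else ?w) (ts ! l)) =
            (\<Prod>l<j. ?w (ts ! l) * (if l = i then c (graft ss) (ts ! i) else 1))"
          by (rule prod.cong) auto
        then show ?thesis using i by (simp add: prod.distrib prod.delta)
      qed
      then show "g ts = (if ?k = j then \<Prod>i<j. ?w (ts ! i) * c (ss ! i) (ts ! i) else 0)
        + (\<Sum>i<j. \<Prod>l<j. (if l = i then \<lambda>t. ?w t * c (graft ss) t else ?w) (ts ! l))"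
        unfolding g_def len by (simp add: distrib_left prod.distrib sum_distrib_left)
    qed
    also have "\<dots> = (if ?k = j then \<Sum>ts\<in>reduced_forests j n. \<Prod>i<j. ?w (ts ! i) * c (ss ! i) (ts ! i) else 0)
        + (\<Sum>i<j. \<Sum>ts\<in>reduced_forests j n. \<Prod>l<j. (if l = i then \<lambda>t. ?w t * c (graft ss) t else ?w) (ts ! l))"
      by (simp add: sum.distrib sum.swap[of _ "reduced_forests j n"])
    also have "\<dots> = (if ?k = j then fps_nth (\<Prod>i<?k. embedding_gf p (ss ! i)) n else 0)
        + (\<Sum>i<j. fps_nth (\<Prod>l<j. tree_gf (if l = i then \<lambda>t. ?w t * c (graft ss) t else ?w)) n)"
      unfolding prod_tree_gf_nth embedding_gf_def c_def by simp
    also have "(\<Sum>i<j. fps_nth (\<Prod>l<j. tree_gf (if l = i then \<lambda>t. ?w t * c (graft ss) t else ?w)) n)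
        = (\<Sum>i<j. fps_nth (\<Phi> ^ (j - 1) * ?G) n)"
    proof (rule sum.cong[OF refl])
      fix i assume "i \<in> {..<j}"
      then have i: "i < j" by simp
      have "(\<Prod>l<j. tree_gf (if l = i then \<lambda>t. ?w t * c (graft ss) t else ?w)) = (\<Prod>l<j. if l = i then ?G else \<Phi>)"
        by (rule prod.cong) (auto simp: embedding_gf_def c_def \<Phi>_def)
      then show "fps_nth (\<Prod>l<j. tree_gf (if l = i then \<lambda>t. ?w t * c (graft ss) t else ?w)) n
          = fps_nth (\<Phi> ^ (j - 1) * ?G) n"
        by (simp add: prod_replace_one[OF i] mult.commute)
    qed
    finally show ?thesis by simp
  qed
  have "fps_nth ?G n = fps_nth (fps_const (pmf p ?k) *
      (if ss = [] then fps_X else \<Prod>i<?k. embedding_gf p (ss ! i)) + Phi1 p \<Phi> * ?G) n" for n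
  proof -
    have "fps_nth ?G n = (if n = 1 then pmf p 0 * g [] else 0)
        + (\<Sum>j=2..n. pmf p j * (\<Sum>ts\<in>reduced_forests j n. g ts))"
      unfolding embedding_gf_def by (rule tree_gf_nth_graft) (use h in \<open>simp add: c_def\<close>)
    also have "(\<Sum>j=2..n. pmf p j * (\<Sum>ts\<in>reduced_forests j n. g ts)) =
        (\<Sum>j=2..n. if ?k = j then pmf p j * fps_nth (\<Prod>i<?k. embedding_gf p (ss ! i)) n else 0)
        + (\<Sum>j=2..n. real j * pmf p j * fps_nth (\<Phi> ^ (j - 1) * ?G) n)"
      unfolding sum_g sum.distrib[symmetric] by (intro sum.cong refl) (simp add: algebra_simps)
    also have "(\<Sum>j=2..n. real j * pmf p j * fps_nth (\<Phi> ^ (j - 1) * ?G) n) = fps_nth (Phi1 p \<Phi> * ?G) n"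
      by (rule Phi1_mult_nth[symmetric]) (simp_all add: \<Phi>_def embedding_gf_def)
    also have "(\<Sum>j=2..n. if ?k = j then pmf p j * fps_nth (\<Prod>i<?k. embedding_gf p (ss ! i)) n else 0) =
        (if ss = [] then 0 else pmf p ?k * fps_nth (\<Prod>i<?k. embedding_gf p (ss ! i)) n)"
    proof -
      \<comment> \<open>The recursion sees the product of the branch series only for \<open>2 \<le> k \<le> n\<close>. For \<open>k > n\<close> its
        coefficient vanishes, and for \<open>k = 1\<close> the factor \<open>p\<^sub>1\<close> does.\<close>
      have "reduced_forests ?k n = {}" if "n < ?k"
        using that length_le_leaves reduced_forests_plane
        by (auto simp: reduced_forests_def) (metis leD reduced_treesD)
      then have "fps_nth (\<Prod>i<?k. embedding_gf p (ss ! i)) n = 0" if "n < ?k"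
        using that unfolding embedding_gf_def prod_tree_gf_nth by simp
      moreover have "?k = 0 \<or> ?k = 1 \<or> 2 \<le> ?k" by linarith
      ultimately show ?thesis using p1 by (auto simp: sum.delta not_le)
    qed
    also have "(if n = 1 then pmf p 0 * g [] else 0) = (if ss = [] then pmf p 0 * fps_nth fps_X n else 0)"
      by (simp add: g_def)
    finally show ?thesis by simp
  qed
  then have "?G = fps_const (pmf p ?k) *
      (if ss = [] then fps_X else \<Prod>i<?k. embedding_gf p (ss ! i)) + Phi1 p \<Phi> * ?G"
    by (simp only: fps_eq_iff) blast
  then show ?thesis by (simp add: algebra_simps)
qed

text \<open>
  Every vertex of \<open>\<tau>\<close> contributes one equation, hence one factor \<open>1 - \<Phi>\<^sub>1\<close>. Its reciprocal is the geometric
  series of the stretched paths that end in the image of that vertex.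
\<close>

lemma embedding_gf_closed:
  assumes p1: "pmf p 1 = 0" and \<tau>: "plane_tree \<tau>"
  shows "(1 - Phi1 p (reduced_gf p)) ^ card \<tau> * embedding_gf p \<tau> =
    fps_const (tree_prob p \<tau>) * fps_X ^ card (leaves \<tau>)"
  using \<tau>
proof (induction rule: plane_tree_induct)
  case (graft ss)
  let ?D = "1 - Phi1 p (reduced_gf p)" and ?k = "length ss"
  have card: "card (graft ss) = Suc (\<Sum>i<?k. card (ss ! i))"
    by (rule card_graft) (use graft plane_tree_finite in blast)
  have step: "?D ^ card (graft ss) * embedding_gf p (graft ss) = ?D ^ (\<Sum>i<?k. card (ss ! i)) *
      (fps_const (pmf p ?k) * (if ss = [] then fps_X else \<Prod>i<?k. embedding_gf p (ss ! i)))"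
    unfolding card embedding_gf_graft[OF p1 graft.hyps, symmetric] by (simp add: mult_ac)
  show ?case
  proof (cases "ss = []")
    case True
    then show ?thesis
      unfolding step using tree_prob_graft[of ss] card_leaves_graft[of ss] by simp
  next
    case False
    have "?D ^ (\<Sum>i<?k. card (ss ! i)) * (\<Prod>i<?k. embedding_gf p (ss ! i)) =
        (\<Prod>i<?k. ?D ^ card (ss ! i) * embedding_gf p (ss ! i))"
      by (simp add: power_sum prod.distrib)
    also have "\<dots> = (\<Prod>i<?k. fps_const (tree_prob p (ss ! i)) * fps_X ^ card (leaves (ss ! i)))"
      by (rule prod.cong) (use graft.IH in auto)
    also have "\<dots> = fps_const (\<Prod>i<?k. tree_prob p (ss ! i)) * fps_X ^ (\<Sum>i<?k. card (leaves (ss ! i)))"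
    proof -
      have "(\<Prod>i\<in>A. fps_const (f i)) = fps_const (\<Prod>i\<in>A. f i)" for A and f :: "nat \<Rightarrow> real"
        by (induction A rule: infinite_finite_induct) (auto simp: fps_const_mult)
      then show ?thesis by (simp add: power_sum prod.distrib)
    qed
    finally have "?D ^ (\<Sum>i<?k. card (ss ! i)) * (\<Prod>i<?k. embedding_gf p (ss ! i)) =
        fps_const (\<Prod>i<?k. tree_prob p (ss ! i)) * fps_X ^ card (leaves (graft ss))"
      using card_leaves_graft[OF graft.hyps] False by simp
    then show ?thesis
      unfolding step tree_prob_graft[OF graft.hyps] using False
      by (simp add: mult.left_commute fps_const_mult[symmetric] mult.assoc del: fps_const_mult)
  qed
qed

text \<open>
  Differentiate the functional equation; since \<open>p\<^sub>1 = 0\<close>, the series \<open>\<Phi>\<^sub>1\<close> is \<open>P' \<circ> \<Phi>\<close>.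
\<close>

lemma Phi1_deriv:
  assumes p1: "pmf p 1 = 0" and f: "leaf_gf p f"
  shows "(1 - Phi1 p f) * fps_deriv f = fps_const (pmf p 0)"
proof -
  have f0: "fps_nth f 0 = 0" using f by (simp add: leaf_gf_def)
  have "fps_deriv (offspring_fps p) = Abs_fps (\<lambda>k. if k \<ge> 1 then real (k + 1) * pmf p (k + 1) else 0)"
  proof (rule fps_ext)
    fix k show "fps_nth (fps_deriv (offspring_fps p)) k =
        fps_nth (Abs_fps (\<lambda>k. if k \<ge> 1 then real (k + 1) * pmf p (k + 1) else 0)) k"
      using p1 by (cases k) (auto simp: offspring_fps_def)
  qed
  then have Phi1: "Phi1 p f = fps_compose (fps_deriv (offspring_fps p)) f" by (simp add: Phi1_def)
  have "fps_deriv f = fps_deriv (fps_compose (offspring_fps p) f + fps_const (pmf p 0) * (fps_X - 1))"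
    by (rule arg_cong[OF leaf_gf_eq[OF f]])
  also have "\<dots> = Phi1 p f * fps_deriv f + fps_const (pmf p 0)"
    by (simp add: fps_compose_deriv[OF f0] Phi1)
  finally show ?thesis by (simp add: algebra_simps)
qed

lemma embedding_gf_nth:
  assumes p0: "pmf p 0 > 0" and p1: "pmf p 1 = 0" and \<tau>: "plane_tree \<tau>" and n: "card (leaves \<tau>) \<le> n"
  defines "\<Phi> \<equiv> reduced_gf p"
  shows "fps_nth (embedding_gf p \<tau>) n = tree_prob p \<tau> / pmf p 0 *
    fps_nth (inverse ((1 - Phi1 p \<Phi>) ^ card (tree_edges \<tau>)) * fps_deriv \<Phi>) (n - card (leaves \<tau>))"
proof -
  let ?D = "1 - Phi1 p \<Phi>" and ?e = "card (tree_edges \<tau>)"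
  let ?H = "inverse (?D ^ ?e) * fps_deriv \<Phi>"
  have D0: "fps_nth ?D 0 = 1" by (simp add: Phi1_def fps_compose_nth)
  then have "fps_nth (?D ^ ?e) 0 \<noteq> 0" by (simp add: fps_power_zeroth)
  then have inv: "inverse (?D ^ ?e) * ?D ^ ?e = 1" by (rule inverse_mult_eq_1)
  have "?D \<noteq> 0" using D0 by (metis fps_zero_nth zero_neq_one)
  have deriv: "?D * fps_deriv \<Phi> = fps_const (pmf p 0)"
    unfolding \<Phi>_def by (rule Phi1_deriv[OF p1 leaf_gf_reduced_gf[OF p1]])
  have "?D ^ Suc ?e * ?H = (inverse (?D ^ ?e) * ?D ^ ?e) * (?D * fps_deriv \<Phi>)"
    by (simp add: mult_ac)
  also have "\<dots> = fps_const (pmf p 0)"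
    by (simp only: inv deriv mult_1_left)
  finally have H: "?D ^ Suc ?e * ?H = fps_const (pmf p 0)" .
  have G: "?D ^ Suc ?e * embedding_gf p \<tau> = fps_const (tree_prob p \<tau>) * fps_X ^ card (leaves \<tau>)"
    using embedding_gf_closed[OF p1 \<tau>] card_tree_edges[OF \<tau>] by (simp add: \<Phi>_def)
  have "?D ^ Suc ?e * (fps_const (pmf p 0) * embedding_gf p \<tau>) =
      fps_const (pmf p 0) * (?D ^ Suc ?e * embedding_gf p \<tau>)"
    by (simp only: mult_ac)
  also have "\<dots> = (?D ^ Suc ?e * ?H) * (fps_const (tree_prob p \<tau>) * fps_X ^ card (leaves \<tau>))"
    by (simp only: G H)
  also have "\<dots> = ?D ^ Suc ?e * (fps_const (tree_prob p \<tau>) * (fps_X ^ card (leaves \<tau>) * ?H))"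
    by (simp only: mult_ac)
  finally have "fps_const (pmf p 0) * embedding_gf p \<tau> =
      fps_const (tree_prob p \<tau>) * (fps_X ^ card (leaves \<tau>) * ?H)"
    by (rule iffD1[OF mult_left_cancel[OF power_not_zero[OF \<open>?D \<noteq> 0\<close>]]])
  then have "fps_nth (fps_const (pmf p 0) * embedding_gf p \<tau>) n =
      fps_nth (fps_const (tree_prob p \<tau>) * (fps_X ^ card (leaves \<tau>) * ?H)) n" by simp
  then have "pmf p 0 * fps_nth (embedding_gf p \<tau>) n = tree_prob p \<tau> * fps_nth ?H (n - card (leaves \<tau>))"
    using n by (simp only: fps_mult_left_const_nth fps_X_power_mult_nth) simp
  then show ?thesis using p0 by (simp add: field_simps)
qed

section \<open>Total mass of the finite trees\<close>

lemma sum_fps_mult_ge: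
  fixes f g :: "real fps"
  assumes f: "\<And>n. 0 \<le> fps_nth f n" and g: "\<And>n. 0 \<le> fps_nth g n"
  shows "(\<Sum>n\<le>A. fps_nth f n) * (\<Sum>n\<le>B. fps_nth g n) \<le> (\<Sum>n\<le>A + B. fps_nth (f * g) n)"
proof -
  have fin: "finite {(i, j). i + j \<le> A + B}"
    by (rule finite_subset[of _ "{..A + B} \<times> {..A + B}"]) auto
  have "(\<Sum>n\<le>A. fps_nth f n) * (\<Sum>n\<le>B. fps_nth g n) =
      (\<Sum>(i, j)\<in>{..A} \<times> {..B}. fps_nth f i * fps_nth g j)"
    by (simp add: sum_product sum.cartesian_product)
  also have "\<dots> \<le> (\<Sum>(i, j)\<in>{(i, j). i + j \<le> A + B}. fps_nth f i * fps_nth g j)"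
    by (rule sum_mono2[OF fin]) (use f g in auto)
  also have "\<dots> = (\<Sum>n\<le>A + B. fps_nth (f * g) n)"
    by (simp add: sum.triangle_reindex_eq fps_mult_nth atLeast0AtMost)
  finally show ?thesis .
qed

lemma fps_power_nonneg:
  fixes f :: "real fps"
  assumes "\<And>n. 0 \<le> fps_nth f n"
  shows "0 \<le> fps_nth (f ^ j) n"
  by (induction j arbitrary: n) (auto simp: fps_mult_nth assms intro!: sum_nonneg mult_nonneg_nonneg)

lemma sum_fps_power_ge:
  fixes f :: "real fps"
  assumes f: "\<And>n. 0 \<le> fps_nth f n"
  shows "(\<Sum>n\<le>A. fps_nth f n) ^ j \<le> (\<Sum>n\<le>j * A. fps_nth (f ^ j) n)"
proof (induction j)
  case (Suc j)
  have "(\<Sum>n\<le>A. fps_nth f n) ^ Suc j \<le> (\<Sum>n\<le>A. fps_nth f n) * (\<Sum>n\<le>j * A. fps_nth (f ^ j) n)"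
    using Suc f by (simp add: mult_left_mono sum_nonneg)
  also have "\<dots> \<le> (\<Sum>n\<le>A + j * A. fps_nth (f * f ^ j) n)"
    by (rule sum_fps_mult_ge) (use f fps_power_nonneg in auto)
  finally show ?case by simp
qed simp

lemma pmf_nat_sums: "pmf p sums (1::real)" for p :: "nat pmf"
proof -
  have "(\<lambda>i. measure (measure_pmf p) {i}) sums measure (measure_pmf p) (\<Union>i. {i})"
    by (rule finite_measure.finite_measure_UNION) (auto simp: disjoint_family_on_def measure_pmf.finite_measure_axioms)
  moreover have "(\<Union>i. {i}) = (UNIV :: nat set)" by auto
  ultimately show ?thesis by (simp add: measure_pmf_single)
qed

text \<open>
  A truncated form of \<open>P(\<Phi>(1)) \<le> \<Phi>(1)\<close>: truncating the outer sum at \<open>J\<close> and the inner series at \<open>A\<close> involves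
  only degrees up to \<open>J * A\<close>.
\<close>

lemma leaf_gf_partial_sum_ge:
  assumes p1: "pmf p 1 = 0" and f: "leaf_gf p f" and nn: "\<And>n. 0 \<le> fps_nth f n"
    and N: "1 \<le> N" "J * A \<le> N"
  shows "(\<Sum>j\<le>J. pmf p j * (\<Sum>n\<le>A. fps_nth f n) ^ j) \<le> (\<Sum>n\<le>N. fps_nth f n)"
proof -
  have f0: "fps_nth f 0 = 0" using f by (simp add: leaf_gf_def)
  let ?S = "\<Sum>n\<le>A. fps_nth f n"
  have coeff: "fps_nth f n = (if n = 1 then pmf p 0 else 0) + (\<Sum>j=2..n. pmf p j * fps_nth (f ^ j) n)" for n
    unfolding leaf_gf_rhs_nth[OF p1, symmetric]
    by (rule arg_cong[OF leaf_gf_eq[OF f], of "\<lambda>F. fps_nth F n"])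
  have ge: "(if n = 1 then pmf p 0 else 0) + (\<Sum>j=2..J. pmf p j * fps_nth (f ^ j) n) \<le> fps_nth f n" for n
  proof -
    have "(\<Sum>j=2..J. pmf p j * fps_nth (f ^ j) n) = (\<Sum>j\<in>{2..J} \<inter> {2..n}. pmf p j * fps_nth (f ^ j) n)"
      by (rule sum.mono_neutral_right) (use startsby_zero_power_prefix[OF f0] in auto)
    also have "\<dots> \<le> (\<Sum>j=2..n. pmf p j * fps_nth (f ^ j) n)"
      by (rule sum_mono2) (auto intro!: mult_nonneg_nonneg fps_power_nonneg nn)
    finally show ?thesis using coeff[of n] by linarith
  qed
  have pow: "?S ^ j \<le> (\<Sum>n\<le>N. fps_nth (f ^ j) n)" if "j \<le> J" for j
  proof -
    have "j * A \<le> N" using that N(2) by (meson le_trans mult_le_mono1)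
    then have "(\<Sum>n\<le>j * A. fps_nth (f ^ j) n) \<le> (\<Sum>n\<le>N. fps_nth (f ^ j) n)"
      by (intro sum_mono2) (auto intro!: fps_power_nonneg nn)
    then show ?thesis using sum_fps_power_ge[of f A j, OF nn] by linarith
  qed
  have "(\<Sum>j\<le>J. pmf p j * ?S ^ j) \<le> pmf p 0 + (\<Sum>j=2..J. pmf p j * ?S ^ j)"
    using sum_split_0_1[of "\<lambda>j. pmf p j * ?S ^ j" J] p1 by (auto simp: atLeast0AtMost)
  also have "\<dots> \<le> pmf p 0 + (\<Sum>j=2..J. pmf p j * (\<Sum>n\<le>N. fps_nth (f ^ j) n))"
    by (intro add_left_mono sum_mono mult_left_mono pow) auto
  also have "\<dots> = (\<Sum>n\<le>N. (if n = 1 then pmf p 0 else 0) + (\<Sum>j=2..J. pmf p j * fps_nth (f ^ j) n))"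
    using N(1) by (simp add: sum.distrib sum_distrib_left sum.swap[of _ "{..N}"])
  also have "\<dots> \<le> (\<Sum>n\<le>N. fps_nth f n)" by (intro sum_mono ge)
  finally show ?thesis .
qed

lemma leaf_gf_sums_1:
  assumes p1: "pmf p 1 = 0" and mean: "(\<lambda>j. real j * pmf p j) sums 1"
    and f: "leaf_gf p f" and nn: "\<And>n. 0 \<le> fps_nth f n" and le: "\<And>N. (\<Sum>n\<le>N. fps_nth f n) \<le> 1"
  shows "fps_nth f sums 1"
proof -
  have summ: "summable (fps_nth f)"
  proof (rule summableI_nonneg_bounded[where x = 1, OF nn])
    fix n show "(\<Sum>i<n. fps_nth f i) \<le> 1"
      using le[of n] nn by (simp add: lessThan_Suc_atMost[symmetric]) (smt (verit) nn)
  qed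
  define s where "s = suminf (fps_nth f)"
  have sums: "(\<lambda>N. \<Sum>n\<le>N. fps_nth f n) \<longlonglongrightarrow> s"
    using summ unfolding s_def by (rule summable_LIMSEQ')
  have s0: "0 \<le> s" unfolding s_def by (rule suminf_nonneg[OF summ nn])
  have s1: "s \<le> 1" by (rule LIMSEQ_le_const2[OF sums]) (use le in auto)
  have partial: "(\<Sum>n\<le>N. fps_nth f n) \<le> s" for N
    unfolding s_def by (rule sum_le_suminf[OF summ]) (use nn in auto)
  have fix_le: "(\<Sum>j\<le>J. pmf p j * s ^ j) \<le> s" for J
  proof (rule LIMSEQ_le_const2)
    show "(\<lambda>A. \<Sum>j\<le>J. pmf p j * (\<Sum>n\<le>A. fps_nth f n) ^ j) \<longlonglongrightarrow> (\<Sum>j\<le>J. pmf p j * s ^ j)"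
      by (intro tendsto_intros sums)
    have "(\<Sum>j\<le>J. pmf p j * (\<Sum>n\<le>A. fps_nth f n) ^ j) \<le> s" for A
      using leaf_gf_partial_sum_ge[OF p1 f nn, of "Suc (J * A)" J A] partial[of "Suc (J * A)"] by linarith
    then show "\<exists>N. \<forall>A\<ge>N. (\<Sum>j\<le>J. pmf p j * (\<Sum>n\<le>A. fps_nth f n) ^ j) \<le> s" by blast
  qed
  have "s = 1"
  proof (rule ccontr)
    assume "s \<noteq> 1"
    then have s: "s < 1" using s1 by simp
    \<comment> \<open>The terms of \<open>P(s) - s\<close>, rewritten with \<open>P(1) = 1\<close> and mean one so that each is nonnegative.
      As their sum is at most 0, they all vanish.\<close>
    define d where "d j = pmf p j * (s ^ j - 1 + real j * (1 - s))" for j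
    have bern: "0 \<le> s ^ j - 1 + real j * (1 - s)" for j
      using Bernoulli_inequality[of "s - 1" j] s0 by (simp add: algebra_simps)
    have d0: "0 \<le> d j" for j unfolding d_def using bern by simp
    have "(\<lambda>J. s - (\<Sum>j\<le>J. pmf p j) + (1 - s) * (\<Sum>j\<le>J. real j * pmf p j)) \<longlonglongrightarrow> s - 1 + (1 - s) * 1"
      using pmf_nat_sums[of p] mean unfolding sums_def_le by (intro tendsto_intros)
    then have lim: "(\<lambda>J. s - (\<Sum>j\<le>J. pmf p j) + (1 - s) * (\<Sum>j\<le>J. real j * pmf p j)) \<longlonglongrightarrow> 0" by simp
    have "d i \<le> 0" for i
    proof (rule LIMSEQ_le_const[OF lim], intro exI allI impI)
      fix J assume "i \<le> J"
      then have "d i \<le> (\<Sum>j\<le>J. d j)" by (intro member_le_sum) (use d0 in auto)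
      also have "\<dots> = (\<Sum>j\<le>J. pmf p j * s ^ j) - (\<Sum>j\<le>J. pmf p j) + (1 - s) * (\<Sum>j\<le>J. real j * pmf p j)"
        unfolding d_def by (simp add: sum.distrib sum_subtractf sum_distrib_left algebra_simps)
      also have "\<dots> \<le> s - (\<Sum>j\<le>J. pmf p j) + (1 - s) * (\<Sum>j\<le>J. real j * pmf p j)"
        using fix_le[of J] by simp
      finally show "d i \<le> s - (\<Sum>j\<le>J. pmf p j) + (1 - s) * (\<Sum>j\<le>J. real j * pmf p j)" .
    qed
    then have dz: "d i = 0" for i using d0 by (simp add: antisym)
    have pz: "pmf p i = 0" if "2 \<le> i" for i
    proof -
      have "0 < s ^ i - 1 + real i * (1 - s)"
      proof -
        obtain k where k: "i = Suc (Suc k)" using \<open>2 \<le> i\<close> by (metis add_2_eq_Suc le_Suc_ex)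
        \<comment> \<open>Bernoulli for the exponent \<open>i - 1\<close>, times \<open>s\<close>, leaves the strictly positive gap
          \<open>(i - 1) (1 - s)^2\<close>.\<close>
        have "s * (1 + real (Suc k) * (s - 1)) \<le> s * s ^ Suc k"
          using Bernoulli_inequality[of "s - 1" "Suc k"] s0 by (intro mult_left_mono) auto
        moreover have "s * (1 + real (Suc k) * (s - 1)) - 1 + real i * (1 - s) = real (Suc k) * (1 - s) ^ 2"
          by (simp add: k algebra_simps power2_eq_square)
        moreover have "0 < real (Suc k) * (1 - s) ^ 2" using s by simp
        ultimately show ?thesis by (simp add: k)
      qed
      then show ?thesis using dz[of i] unfolding d_def by simp
    qed
    have "real j * pmf p j = 0" for j
      using pz[of j] p1 by (cases "j = 0 \<or> j = 1") auto
    then have "(\<lambda>j. real j * pmf p j) sums 0" by (simp only: sums_zero)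
    then show False using mean sums_unique2 by fastforce
  qed
  then show ?thesis using summ s_def by (simp add: sums_iff)
qed

section \<open>The law of the terminal tree\<close>

context
  fixes M :: "'w measure" and p :: "nat pmf" and X :: "nat list \<Rightarrow> 'w \<Rightarrow> nat"
  assumes bp: "branching_process M p X"
begin

interpretation prob_space M
  using bp by (simp add: branching_process_def)

lemma offspring_measurable: "X u \<in> measurable M (count_space UNIV)"
  using bp by (auto simp: branching_process_def indep_vars_def2)

lemma offspring_prob: "prob (X u -` {k} \<inter> space M) = pmf p k"
proof -
  have "prob (X u -` {k} \<inter> space M) = measure (distr M (count_space UNIV) (X u)) {k}"
    by (subst measure_distr) (auto intro: offspring_measurable)
  also have "\<dots> = pmf p k" using bp by (simp add: branching_process_def measure_pmf_single)
  finally show ?thesis .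
qed

lemma terminal_tree_event:
  assumes "plane_tree t"
  shows "{\<omega> \<in> space M. terminal_tree X \<omega> = t} = (\<Inter>u\<in>t. X u -` {outdeg t u} \<inter> space M)"
  using plane_tree_root[OF assms] by (auto simp: terminal_tree_def family_tree_eq_iff[OF assms])

lemma terminal_tree_event_sets:
  assumes t: "plane_tree t"
  shows "{\<omega> \<in> space M. terminal_tree X \<omega> = t} \<in> sets M"
  unfolding terminal_tree_event[OF t]
  using plane_tree_finite[OF t] plane_tree_root[OF t] measurable_sets[OF offspring_measurable]
  by (intro sets.finite_INT) auto

lemma prob_terminal_tree:
  assumes t: "plane_tree t"
  shows "\<P>(\<omega> in M. terminal_tree X \<omega> = t) = tree_prob p t"
proof -
  have "prob (\<Inter>u\<in>t. X u -` {outdeg t u} \<inter> space M) = (\<Prod>u\<in>t. prob (X u -` {outdeg t u} \<inter> space M))"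
    by (rule indep_varsD[where I = UNIV and M' = "\<lambda>_. count_space UNIV"])
      (use bp plane_tree_finite[OF t] plane_tree_root[OF t] in \<open>auto simp: branching_process_def\<close>)
  then show ?thesis unfolding terminal_tree_event[OF t] tree_prob_def by (simp add: offspring_prob)
qed

lemma countable_plane_trees: "countable {t. plane_tree t}"
proof (rule countable_subset)
  show "{t. plane_tree t} \<subseteq> {t. finite t \<and> t \<subseteq> UNIV}" using plane_tree_finite by auto
  show "countable {t. finite t \<and> t \<subseteq> (UNIV :: nat list set)}"
    by (rule countable_Collect_finite_subset) simp
qed

text \<open>
  There are countably many finite trees, and each one with a unary vertex has probability 0.
\<close>

lemma AE_reduced_terminal_tree:
  assumes p1: "pmf p 1 = 0"
  shows "AE \<omega> in M. \<forall>t. plane_tree t \<and> terminal_tree X \<omega> = t \<longrightarrow> t \<in> reduced_trees (card (leaves t))"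
proof -
  have "AE \<omega> in M. \<forall>t\<in>{t. plane_tree t}. terminal_tree X \<omega> = t \<longrightarrow> t \<in> reduced_trees (card (leaves t))"
  proof (subst AE_ball_countable[OF countable_plane_trees], intro ballI)
    fix t :: "nat list set" assume "t \<in> {t. plane_tree t}"
    then have t: "plane_tree t" by simp
    show "AE \<omega> in M. terminal_tree X \<omega> = t \<longrightarrow> t \<in> reduced_trees (card (leaves t))"
    proof (cases "\<exists>u\<in>t. outdeg t u = 1")
      case True
      then obtain u where "u \<in> t" "pmf p (outdeg t u) = 0" using p1 by metis
      then have "tree_prob p t = 0"
        unfolding tree_prob_def using plane_tree_finite[OF t] by (intro prod_zero) blast+
      then have "AE \<omega> in M. \<omega> \<notin> {\<omega> \<in> space M. terminal_tree X \<omega> = t}"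
        using prob_eq_0[OF terminal_tree_event_sets[OF t]] prob_terminal_tree[OF t] by simp
      with AE_space show ?thesis by eventually_elim auto
    next
      case False
      then have "t \<in> reduced_trees (card (leaves t))" using t by (auto simp: reduced_trees_def)
      then show ?thesis by simp
    qed
  qed
  then show ?thesis by simp
qed

lemma has_leaves_iff:
  "has_leaves X n \<omega> \<longleftrightarrow> plane_tree (terminal_tree X \<omega>) \<and> card (leaves (terminal_tree X \<omega>)) = n"
  unfolding has_leaves_def stops_iff_plane_tree terminal_tree_def ..

text \<open>
  The event is a countable union over the possible terminal trees.
\<close>

lemma has_leaves_conj_sets:
  assumes Q: "\<And>t. plane_tree t \<Longrightarrow> {\<omega> \<in> space M. Q t \<omega>} \<in> sets M"
  shows "{\<omega> \<in> space M. has_leaves X n \<omega> \<and> Q (terminal_tree X \<omega>) \<omega>} \<in> sets M"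
proof -
  have "{\<omega> \<in> space M. has_leaves X n \<omega> \<and> Q (terminal_tree X \<omega>) \<omega>} =
      (\<Union>t\<in>{t. plane_tree t} \<inter> {t. card (leaves t) = n}.
        {\<omega> \<in> space M. terminal_tree X \<omega> = t} \<inter> {\<omega> \<in> space M. Q t \<omega>})"
    by (auto simp: has_leaves_iff)
  also have "\<dots> \<in> sets M"
    by (intro sets.countable_UN' countable_Int1 countable_plane_trees sets.Int)
      (auto intro: terminal_tree_event_sets Q)
  finally show ?thesis .
qed

text \<open>
  Decomposition according to the terminal tree: up to a null set, the trees with \<open>n\<close> leaves form a finite
  partition of the event.
\<close>

lemma prob_has_leaves_conj:
  assumes p1: "pmf p 1 = 0"
    and Q: "\<And>t. plane_tree t \<Longrightarrow> {\<omega> \<in> space M. Q t \<omega>} \<in> sets M"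
  shows "\<P>(\<omega> in M. has_leaves X n \<omega> \<and> Q (terminal_tree X \<omega>) \<omega>) =
    (\<Sum>t\<in>reduced_trees n. \<P>(\<omega> in M. terminal_tree X \<omega> = t \<and> Q t \<omega>))"
proof (rule prob_sum)
  show "AE \<omega> in M. (\<forall>t\<in>reduced_trees n. terminal_tree X \<omega> = t \<and> Q t \<omega> \<longrightarrow>
        has_leaves X n \<omega> \<and> Q (terminal_tree X \<omega>) \<omega>) \<and>
      (has_leaves X n \<omega> \<and> Q (terminal_tree X \<omega>) \<omega> \<longrightarrow>
        (\<exists>!t. t \<in> reduced_trees n \<and> terminal_tree X \<omega> = t \<and> Q t \<omega>))"
    using AE_reduced_terminal_tree[OF p1]
    by eventually_elim (auto simp: has_leaves_iff reduced_trees_def)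
next
  fix t assume "t \<in> reduced_trees n"
  then have t: "plane_tree t" by (rule reduced_treesD)
  have "{\<omega> \<in> space M. terminal_tree X \<omega> = t \<and> Q t \<omega>} =
      {\<omega> \<in> space M. terminal_tree X \<omega> = t} \<inter> {\<omega> \<in> space M. Q t \<omega>}" by auto
  then show "{\<omega> \<in> space M. terminal_tree X \<omega> = t \<and> Q t \<omega>} \<in> sets M"
    using terminal_tree_event_sets[OF t] Q[OF t] by simp
qed (use has_leaves_conj_sets[OF Q] in auto)

lemma has_leaves_sets: "{\<omega> \<in> space M. has_leaves X n \<omega>} \<in> sets M"
  using has_leaves_conj_sets[of "\<lambda>_ _. True" n] by simp

lemma prob_has_leaves:
  assumes p1: "pmf p 1 = 0"
  shows "\<P>(\<omega> in M. has_leaves X n \<omega>) = fps_nth (reduced_gf p) n"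
proof -
  have "\<P>(\<omega> in M. has_leaves X n \<omega>) = (\<Sum>t\<in>reduced_trees n. \<P>(\<omega> in M. terminal_tree X \<omega> = t))"
    using prob_has_leaves_conj[OF p1, of "\<lambda>_ _. True" n] by simp
  also have "\<dots> = (\<Sum>t\<in>reduced_trees n. tree_prob p t)"
    by (intro sum.cong refl prob_terminal_tree reduced_treesD)
  finally show ?thesis by (simp add: tree_gf_def)
qed

text \<open>
  The events of having \<open>n\<close> leaves are disjoint, so the probability of their union is \<open>\<Phi>(1) = 1\<close>.
\<close>

lemma AE_stops:
  assumes p1: "pmf p 1 = 0" and mean: "(\<lambda>j. real j * pmf p j) sums 1"
  shows "AE \<omega> in M. stops (\<lambda>u. X u \<omega>) \<and> plane_tree (terminal_tree X \<omega>)"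
proof -
  let ?A = "\<lambda>n. {\<omega> \<in> space M. has_leaves X n \<omega>}"
  have sums: "(\<lambda>n. prob (?A n)) sums prob (\<Union>n. ?A n)"
  proof (rule finite_measure_UNION)
    show "range ?A \<subseteq> sets M" using has_leaves_sets by blast
    show "disjoint_family ?A" by (auto simp: disjoint_family_on_def has_leaves_iff)
  qed
  have nn: "0 \<le> fps_nth (reduced_gf p) n" for n
    unfolding prob_has_leaves[OF p1, symmetric] by simp
  have "(\<Sum>n\<le>N. fps_nth (reduced_gf p) n) \<le> 1" for N
  proof -
    have "(\<Sum>n\<le>N. prob (?A n)) \<le> prob (\<Union>n. ?A n)"
      using sum_le_suminf[OF sums_summable[OF sums], of "{..N}"] sums_unique[OF sums] by simp
    also have "\<dots> \<le> 1" by (rule prob_le_1)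
    finally show ?thesis by (simp only: prob_has_leaves[OF p1])
  qed
  then have "fps_nth (reduced_gf p) sums 1"
    by (rule leaf_gf_sums_1[OF p1 mean leaf_gf_reduced_gf[OF p1] nn])
  then have "prob (\<Union>n. ?A n) = 1"
    using sums sums_unique2 unfolding prob_has_leaves[OF p1] by blast
  from AE_prob_1[OF this] show ?thesis
  proof eventually_elim
    case (elim \<omega>)
    then obtain n where "has_leaves X n \<omega>" by blast
    then show ?case using has_leaves_iff[of n \<omega>] by (simp add: has_leaves_def)
  qed
qed

end

section \<open>Labellings that induce a given tree\<close>

lemma card_bijections:
  assumes A: "finite A" and C: "finite C" and eq: "card A = card C"
  shows "card {f \<in> A \<rightarrow>\<^sub>E C. bij_betw f A C} = fact (card A)"
proof -
  have "bij_betw f A C" if "f \<in> A \<rightarrow>\<^sub>E C" "inj_on f A" for f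
    unfolding bij_betw_def using that card_image[OF that(2)] eq C
    by (metis PiE_mem card_subset_eq image_subsetI)
  then have "{f \<in> A \<rightarrow>\<^sub>E C. bij_betw f A C} = {f \<in> A \<rightarrow>\<^sub>E C. inj_on f A}"
    by (auto simp: bij_betw_def)
  moreover have "card {f \<in> A \<rightarrow>\<^sub>E C. inj_on f A} = fact (card A)"
    using card_inj_on_subset_funcset[OF A C subset_refl] eq by (simp add: fact_prod_rev)
  ultimately show ?thesis by simp
qed

text \<open>
  Removing the prescribed points from domain and range leaves the free bijections between the rest.
\<close>

lemma card_bijections_extending:
  assumes A: "finite A" and C: "finite C" and eq: "card A = card C"
    and D: "D \<subseteq> A" and g: "inj_on g D" "g ` D \<subseteq> C"
  shows "card {f \<in> A \<rightarrow>\<^sub>E C. bij_betw f A C \<and> (\<forall>x\<in>D. f x = g x)} = fact (card A - card D)"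
proof -
  let ?F = "{f \<in> A \<rightarrow>\<^sub>E C. bij_betw f A C \<and> (\<forall>x\<in>D. f x = g x)}"
  let ?G = "{h \<in> (A - D) \<rightarrow>\<^sub>E (C - g ` D). bij_betw h (A - D) (C - g ` D)}"
  define glue where "glue h = (\<lambda>x\<in>A. if x \<in> D then g x else h x)" for h
  have finD: "finite D" using A D by (rule finite_subset[rotated])
  have "bij_betw (\<lambda>f. restrict f (A - D)) ?F ?G"
  proof (rule bij_betw_byWitness[where f' = glue])
    show "\<forall>f\<in>?F. glue (restrict f (A - D)) = f"
      by (auto simp: glue_def fun_eq_iff PiE_def extensional_def)
    show "\<forall>h\<in>?G. restrict (glue h) (A - D) = h"
      by (auto simp: glue_def fun_eq_iff PiE_def extensional_def)
    show "(\<lambda>f. restrict f (A - D)) ` ?F \<subseteq> ?G"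
    proof (intro image_subsetI CollectI conjI)
      fix f assume f: "f \<in> ?F"
      then have inj: "inj_on f A" and img: "f ` A = C" and eqg: "f ` D = g ` D"
        by (auto simp: bij_betw_def)
      have "f ` (A - D) = C - g ` D"
        using inj_on_image_set_diff[OF inj, of A D] D img eqg by auto
      moreover have "inj_on f (A - D)" using inj by (rule inj_on_subset) auto
      ultimately have bij: "bij_betw f (A - D) (C - g ` D)" by (simp add: bij_betw_def)
      then show "bij_betw (restrict f (A - D)) (A - D) (C - g ` D)"
        using bij_betw_cong[of "A - D" f "restrict f (A - D)" "C - g ` D"] by simp
      show "restrict f (A - D) \<in> (A - D) \<rightarrow>\<^sub>E (C - g ` D)"
        using bij_betw_imp_funcset[OF bij] by (simp only: restrict_PiE_iff) blast
    qed
    show "glue ` ?G \<subseteq> ?F"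
    proof (intro image_subsetI CollectI conjI)
      fix h assume h: "h \<in> ?G"
      have on_D: "glue h x = g x" if "x \<in> D" for x using that D by (auto simp: glue_def)
      have off_D: "glue h x = h x" if "x \<in> A - D" for x using that by (auto simp: glue_def)
      have "bij_betw (glue h) D (g ` D)"
        using g(1) on_D by (simp add: bij_betw_def cong: inj_on_cong image_cong)
      moreover have "bij_betw (glue h) (A - D) (C - g ` D)"
        using h off_D bij_betw_cong[of "A - D" "glue h" h] by blast
      ultimately have "bij_betw (glue h) (D \<union> (A - D)) (g ` D \<union> (C - g ` D))"
        by (rule bij_betw_combine) auto
      moreover have "D \<union> (A - D) = A" "g ` D \<union> (C - g ` D) = C" using D g by auto
      ultimately show bij: "bij_betw (glue h) A C" by simp
      show "glue h \<in> A \<rightarrow>\<^sub>E C"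
        using bij_betw_imp_funcset[OF bij] by (simp add: PiE_def) (simp add: glue_def)
      show "\<forall>x\<in>D. glue h x = g x" using on_D by blast
    qed
  qed
  then have "card ?F = card ?G" by (rule bij_betw_same_card)
  also have "\<dots> = fact (card (A - D))"
  proof (rule card_bijections)
    show "card (A - D) = card (C - g ` D)"
      using card_Diff_subset[OF finD D] card_Diff_subset[OF _ g(2)] finD card_image[OF g(1)] eq by simp
  qed (use A C in auto)
  also have "card (A - D) = card A - card D" by (rule card_Diff_subset[OF finD D])
  finally show ?thesis .
qed

text \<open>
  A strong embedding prescribes the labels of the images of the leaves of \<open>\<tau>\<close>; the other labels are free. A
  labelling is compatible with at most one strong embedding, because labels determine
  the images of the leaves and these determine the embedding.
\<close>

lemma card_inducing_labellings:
  assumes \<tau>: "leaf_labelled_tree \<tau> lab S" and t: "plane_tree t" and n: "card (leaves t) = n"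
    and S: "S \<noteq> {}" "S \<subseteq> {1..n}"
  shows "card {f \<in> leaves t \<rightarrow>\<^sub>E {1..n}. bij_betw f (leaves t) {1..n} \<and> induces t f S \<tau> lab} =
    card (strong_embeddings \<tau> t) * fact (n - card S)"
proof -
  have pl: "plane_tree \<tau>" and lab: "bij_betw lab (leaves \<tau>) S"
    and bin: "\<And>u. u \<in> \<tau> - leaves \<tau> \<Longrightarrow> outdeg \<tau> u \<ge> 2"
    using \<tau> by (auto simp: leaf_labelled_tree_def)
  let ?E = "strong_embeddings \<tau> t"
  let ?B = "\<lambda>\<phi>. {f \<in> leaves t \<rightarrow>\<^sub>E {1..n}. bij_betw f (leaves t) {1..n} \<and> (\<forall>u\<in>leaves \<tau>. f (\<phi> u) = lab u)}"
  have leaf: "\<phi> u \<in> leaves t" if "\<phi> \<in> ?E" "u \<in> leaves \<tau>" for \<phi> u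
    using strong_embedding_leaf[OF pl t that] .
  have finB: "finite (?B \<phi>)" for \<phi>
    by (rule finite_subset[of _ "leaves t \<rightarrow>\<^sub>E {1..n}"])
      (use finite_leaves[OF t] in \<open>auto intro: finite_PiE\<close>)
  have iff: "induces t f S \<tau> lab \<longleftrightarrow> (\<exists>\<phi>\<in>?E. \<forall>u\<in>leaves \<tau>. f (\<phi> u) = lab u)"
    if "bij_betw f (leaves t) {1..n}" for f
    by (rule induces_iff_strong_embedding[OF \<tau> t _ S(1)]) (use that S(2) in \<open>auto simp: bij_betw_def\<close>)
  have "{f \<in> leaves t \<rightarrow>\<^sub>E {1..n}. bij_betw f (leaves t) {1..n} \<and> induces t f S \<tau> lab} = (\<Union>\<phi>\<in>?E. ?B \<phi>)"
    using iff by auto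
  also have "card \<dots> = (\<Sum>\<phi>\<in>?E. card (?B \<phi>))"
  proof (rule card_UN_disjoint[OF finite_strong_embeddings[OF pl t]])
    show "\<forall>\<phi>\<in>?E. \<forall>\<psi>\<in>?E. \<phi> \<noteq> \<psi> \<longrightarrow> ?B \<phi> \<inter> ?B \<psi> = {}"
    proof (intro ballI impI, rule ccontr)
      fix \<phi> \<psi> assume \<phi>: "\<phi> \<in> ?E" and \<psi>: "\<psi> \<in> ?E" and ne: "\<phi> \<noteq> \<psi>" "?B \<phi> \<inter> ?B \<psi> \<noteq> {}"
      then obtain f where f: "inj_on f (leaves t)" "\<forall>u\<in>leaves \<tau>. f (\<phi> u) = lab u" "\<forall>u\<in>leaves \<tau>. f (\<psi> u) = lab u"
        by (auto simp: bij_betw_def)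
      have "\<phi> u = \<psi> u" if "u \<in> leaves \<tau>" for u
        by (rule inj_onD[OF f(1)]) (use f that leaf \<phi> \<psi> in auto)
      then have "\<phi> = \<psi>" by (intro strong_embedding_unique[OF pl _ \<phi> \<psi>]) (use bin in auto)
      then show False using ne by simp
    qed
  qed (use finB in auto)
  also have "\<dots> = (\<Sum>\<phi>\<in>?E. fact (n - card S))"
  proof (rule sum.cong[OF refl])
    fix \<phi> assume \<phi>: "\<phi> \<in> ?E"
    have inj: "inj_on \<phi> (leaves \<tau>)"
      by (rule inj_on_subset[OF strong_embedding_inj_on[OF pl \<phi>]]) (auto simp: leaves_def)
    define g where "g = lab \<circ> inv_into (leaves \<tau>) \<phi>"
    have g: "g (\<phi> u) = lab u" if "u \<in> leaves \<tau>" for u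
      using inv_into_f_f[OF inj that] by (simp add: g_def)
    have "?B \<phi> = {f \<in> leaves t \<rightarrow>\<^sub>E {1..n}. bij_betw f (leaves t) {1..n} \<and> (\<forall>x\<in>\<phi> ` leaves \<tau>. f x = g x)}"
      using g by auto
    also have "card \<dots> = fact (card (leaves t) - card (\<phi> ` leaves \<tau>))"
    proof (rule card_bijections_extending)
      show "inj_on g (\<phi> ` leaves \<tau>)"
        using lab inj g by (auto simp: inj_on_def bij_betw_def)
      show "g ` \<phi> ` leaves \<tau> \<subseteq> {1..n}"
        using lab S(2) g by (auto simp: bij_betw_def)
    qed (use finite_leaves[OF t] n leaf \<phi> in auto)
    also have "card (\<phi> ` leaves \<tau>) = card S"
      using card_image[OF inj] bij_betw_same_card[OF lab] by simp
    finally show "card (?B \<phi>) = fact (n - card S)" using n by simp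
  qed
  finally show ?thesis by simp
qed

section \<open>The law of the labelled terminal tree\<close>

text \<open>
  Only the labels of vertices of \<open>t\<close> are consulted, which reduces measurability to finitely many labels.
\<close>

lemma induces_cong:
  assumes "\<And>u. u \<in> t \<Longrightarrow> L u = L' u"
  shows "induces t L S \<tau> lab = induces t L' S \<tau> lab"
proof -
  have imp: "induces t L' S \<tau> lab"
    if ind: "induces t L S \<tau> lab" and eq: "\<And>u. u \<in> t \<Longrightarrow> L u = L' u" for L L'
  proof -
    have ll: "labelled_leaves t L S = labelled_leaves t L' S"
      unfolding labelled_leaves_def leaves_def using eq by auto
    then have lca: "lca t L S = lca t L' S" by (simp add: lca_def)
    have sub: "lca_subtree t L S = lca_subtree t L' S" unfolding lca_subtree_def ll lca ..
    obtain \<phi> where iso: "labelled_tree_iso \<phi> [] \<tau> lab (lca t L S) (suppress (lca t L S) (lca_subtree t L S)) L"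
      and deg: "\<forall>u\<in>\<tau>. outdeg t (\<phi> u) = outdeg \<tau> u"
      using ind unfolding induces_def by blast
    have "\<phi> ` \<tau> \<subseteq> lca_subtree t L S"
      using iso unfolding labelled_tree_iso_def bij_betw_def suppress_def by blast
    then have "\<phi> u \<in> t" if "u \<in> leaves \<tau>" for u
      using that lca_subtree_subset[of t L S] by (auto simp: leaves_def)
    then have "labelled_tree_iso \<phi> [] \<tau> lab (lca t L' S) (suppress (lca t L' S) (lca_subtree t L' S)) L'"
      using iso eq unfolding labelled_tree_iso_def lca sub by simp
    then show ?thesis using deg unfolding induces_def by blast
  qed
  show ?thesis using imp[of L L'] imp[of L' L] assms by auto
qed

lemma sets_finitely_many_labels:
  fixes L :: "'i \<Rightarrow> 'w \<Rightarrow> nat"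
  assumes L: "\<And>u. L u \<in> measurable M (count_space UNIV)" and I: "finite I"
  shows "{\<omega> \<in> space M. R (\<lambda>u\<in>I. L u \<omega>)} \<in> sets M"
proof -
  have "{\<omega> \<in> space M. R (\<lambda>u\<in>I. L u \<omega>)} =
      (\<Union>g\<in>{g \<in> I \<rightarrow>\<^sub>E UNIV. R g}. {\<omega> \<in> space M. \<forall>u\<in>I. L u \<omega> = g u})"
  proof (intro equalityI subsetI)
    fix \<omega> assume "\<omega> \<in> {\<omega> \<in> space M. R (\<lambda>u\<in>I. L u \<omega>)}"
    then show "\<omega> \<in> (\<Union>g\<in>{g \<in> I \<rightarrow>\<^sub>E UNIV. R g}. {\<omega> \<in> space M. \<forall>u\<in>I. L u \<omega> = g u})"
      by (intro UN_I[of "\<lambda>u\<in>I. L u \<omega>"]) auto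
  next
    fix \<omega> assume "\<omega> \<in> (\<Union>g\<in>{g \<in> I \<rightarrow>\<^sub>E UNIV. R g}. {\<omega> \<in> space M. \<forall>u\<in>I. L u \<omega> = g u})"
    then obtain g where g: "g \<in> I \<rightarrow>\<^sub>E UNIV" "R g" "\<omega> \<in> space M" "\<forall>u\<in>I. L u \<omega> = g u" by blast
    then have "(\<lambda>u\<in>I. L u \<omega>) = g" by (auto simp: fun_eq_iff PiE_def extensional_def)
    then show "\<omega> \<in> {\<omega> \<in> space M. R (\<lambda>u\<in>I. L u \<omega>)}" using g by simp
  qed
  also have "\<dots> \<in> sets M"
  proof (rule sets.countable_UN')
    have "countable (I \<rightarrow>\<^sub>E (UNIV :: nat set))" by (rule countable_PiE[OF I]) auto
    then show "countable {g \<in> I \<rightarrow>\<^sub>E (UNIV :: nat set). R g}" by (rule countable_subset[rotated]) auto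
    have "{\<omega> \<in> space M. \<forall>u\<in>I. L u \<omega> = g u} \<in> sets M" for g
    proof -
      have "{\<omega> \<in> space M. L u \<omega> = g u} \<in> sets M" for u
        using measurable_sets[OF L, of "{g u}" u] by (simp add: vimage_def Int_def conj_commute)
      then show ?thesis by (intro sets.sets_Collect_finite_All[OF _ I])
    qed
    then show "(\<lambda>g. {\<omega> \<in> space M. \<forall>u\<in>I. L u \<omega> = g u}) ` {g \<in> I \<rightarrow>\<^sub>E UNIV. R g} \<subseteq> sets M" by blast
  qed
  finally show ?thesis .
qed

context
  fixes M :: "'w measure" and p :: "nat pmf" and X L :: "nat list \<Rightarrow> 'w \<Rightarrow> nat"
  assumes bp: "branching_process M p X" and L: "uniform_leaf_labelling M X L"
begin

interpretation prob_space M
  using bp by (simp add: branching_process_def)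

lemma label_event_sets:
  assumes t: "plane_tree t"
  shows "{\<omega> \<in> space M. terminal_tree X \<omega> = t \<and> R (\<lambda>u\<in>t. L u \<omega>)} \<in> sets M"
proof -
  have "{\<omega> \<in> space M. terminal_tree X \<omega> = t \<and> R (\<lambda>u\<in>t. L u \<omega>)} =
      {\<omega> \<in> space M. terminal_tree X \<omega> = t} \<inter> {\<omega> \<in> space M. R (\<lambda>u\<in>t. L u \<omega>)}" by auto
  then show ?thesis
    using terminal_tree_event_sets[OF bp t] plane_tree_finite[OF t] L
      sets_finitely_many_labels[of L M t R]
    by (simp add: uniform_leaf_labelling_def)
qed

lemma induces_restrict: "induces t (\<lambda>u. L u \<omega>) S \<tau> lab = induces t (\<lambda>u\<in>t. L u \<omega>) S \<tau> lab"
  by (rule induces_cong) simp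

lemma prob_labelling:
  assumes t: "plane_tree t" and f: "bij_betw f (leaves t) {1..card (leaves t)}"
  shows "\<P>(\<omega> in M. terminal_tree X \<omega> = t \<and> (\<forall>u\<in>leaves t. L u \<omega> = f u)) =
    tree_prob p t / fact (card (leaves t))"
proof (cases "tree_prob p t = 0")
  case True
  have "\<P>(\<omega> in M. terminal_tree X \<omega> = t \<and> (\<forall>u\<in>leaves t. L u \<omega> = f u)) \<le> \<P>(\<omega> in M. terminal_tree X \<omega> = t)"
    by (rule finite_measure_mono[OF _ terminal_tree_event_sets[OF bp t]]) auto
  then show ?thesis using True prob_terminal_tree[OF bp t] by (simp add: measure_le_0_iff)
next
  case False
  have pos: "0 < tree_prob p t"
    using False by (simp add: prob_terminal_tree[OF bp t, symmetric] zero_less_measure_iff)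
  then have "\<P>(\<omega> in M. (\<forall>u\<in>leaves t. L u \<omega> = f u) \<bar> terminal_tree X \<omega> = t) = 1 / fact (card (leaves t))"
    using L t f prob_terminal_tree[OF bp t] by (simp add: uniform_leaf_labelling_def)
  then show ?thesis
    using pos prob_terminal_tree[OF bp t] by (simp add: cond_prob_def conj_commute field_simps)
qed

text \<open>
  The prescribed probabilities of the bijective labellings already add up to the probability of the tree.
  Almost surely the labelling is therefore one of them, and every event about the labels of the leaves
  is, up to a null set, a finite union of such labellings.
\<close>

lemma prob_label_event:
  assumes t: "plane_tree t"
    and R: "\<And>f g. (\<And>u. u \<in> leaves t \<Longrightarrow> f u = g u) \<Longrightarrow>
      bij_betw f (leaves t) {1..card (leaves t)} \<Longrightarrow> R f \<longleftrightarrow> R g"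
  shows "\<P>(\<omega> in M. terminal_tree X \<omega> = t \<and> R (\<lambda>u\<in>t. L u \<omega>)) =
    tree_prob p t / fact (card (leaves t)) *
    real (card {f \<in> leaves t \<rightarrow>\<^sub>E {1..card (leaves t)}. bij_betw f (leaves t) {1..card (leaves t)} \<and> R f})"
proof -
  let ?n = "card (leaves t)"
  define B where "B = {f \<in> leaves t \<rightarrow>\<^sub>E {1..?n}. bij_betw f (leaves t) {1..?n}}"
  let ?ev = "\<lambda>f \<omega>. terminal_tree X \<omega> = t \<and> (\<forall>u\<in>leaves t. L u \<omega> = f u)"
  have sub: "leaves t \<subseteq> t" by (auto simp: leaves_def)
  have finB: "finite B"
    unfolding B_def by (rule finite_subset[of _ "leaves t \<rightarrow>\<^sub>E {1..?n}"])
      (use finite_leaves[OF t] in \<open>auto intro: finite_PiE\<close>)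
  have ev_sets: "{\<omega> \<in> space M. ?ev f \<omega>} \<in> sets M" for f
    using label_event_sets[OF t, of "\<lambda>g. \<forall>u\<in>leaves t. g u = f u"] sub by (simp add: subset_eq)
  have disj: "f = g" if "f \<in> B" "g \<in> B" "?ev f \<omega>" "?ev g \<omega>" for f g \<omega>
    using that by (intro PiE_ext[of f "leaves t" "\<lambda>_. {1..?n}" g]) (auto simp: B_def)
  have prob_ev: "\<P>(\<omega> in M. ?ev f \<omega>) = tree_prob p t / fact ?n" if "f \<in> B" for f
    by (rule prob_labelling[OF t]) (use that in \<open>simp add: B_def\<close>)
  have any_sets: "{\<omega> \<in> space M. \<exists>f\<in>B. ?ev f \<omega>} \<in> sets M"
    by (rule sets.sets_Collect_finite_Ex[OF ev_sets finB])
  have "\<P>(\<omega> in M. \<exists>f\<in>B. ?ev f \<omega>) = (\<Sum>f\<in>B. \<P>(\<omega> in M. ?ev f \<omega>))"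
    by (rule prob_sum[OF finB ev_sets any_sets]) (use disj in \<open>blast intro: always_eventually\<close>)
  also have "\<dots> = \<P>(\<omega> in M. terminal_tree X \<omega> = t)"
    using card_bijections[of "leaves t" "{1..?n}"] finite_leaves[OF t] prob_ev
    by (simp add: B_def prob_terminal_tree[OF bp t])
  \<comment> \<open>There are \<open>n!\<close> bijections, each taking the share \<open>1 / n!\<close> of the probability of \<open>t\<close>.\<close>
  finally have full: "\<P>(\<omega> in M. \<exists>f\<in>B. ?ev f \<omega>) = \<P>(\<omega> in M. terminal_tree X \<omega> = t)" .
  have "prob ({\<omega> \<in> space M. terminal_tree X \<omega> = t} - {\<omega> \<in> space M. \<exists>f\<in>B. ?ev f \<omega>}) = 0"
    using full finite_measure_Diff[OF terminal_tree_event_sets[OF bp t] any_sets] by auto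
  then have "AE \<omega> in M. \<omega> \<notin> {\<omega> \<in> space M. terminal_tree X \<omega> = t} - {\<omega> \<in> space M. \<exists>f\<in>B. ?ev f \<omega>}"
    using prob_eq_0[OF sets.Diff[OF terminal_tree_event_sets[OF bp t] any_sets]] by simp
  with AE_space have bij: "AE \<omega> in M. terminal_tree X \<omega> = t \<longrightarrow> (\<exists>f\<in>B. ?ev f \<omega>)"
    by eventually_elim auto
  have R_ev: "R (\<lambda>u\<in>t. L u \<omega>) \<longleftrightarrow> R f" if "f \<in> B" "?ev f \<omega>" for f \<omega>
  proof -
    have "R f \<longleftrightarrow> R (\<lambda>u\<in>t. L u \<omega>)" by (rule R) (use that sub in \<open>auto simp: B_def\<close>)
    then show ?thesis by blast
  qed
  have "\<P>(\<omega> in M. terminal_tree X \<omega> = t \<and> R (\<lambda>u\<in>t. L u \<omega>)) = (\<Sum>f\<in>{f \<in> B. R f}. \<P>(\<omega> in M. ?ev f \<omega>))"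
  proof (rule prob_sum)
    show "AE \<omega> in M. (\<forall>f\<in>{f \<in> B. R f}. ?ev f \<omega> \<longrightarrow> terminal_tree X \<omega> = t \<and> R (\<lambda>u\<in>t. L u \<omega>)) \<and>
        (terminal_tree X \<omega> = t \<and> R (\<lambda>u\<in>t. L u \<omega>) \<longrightarrow> (\<exists>!f. f \<in> {f \<in> B. R f} \<and> ?ev f \<omega>))"
      using bij
    proof eventually_elim
      case (elim \<omega>)
      show ?case
      proof (intro conjI ballI impI)
        fix f assume "f \<in> {f \<in> B. R f}" "?ev f \<omega>"
        then show "terminal_tree X \<omega> = t" "R (\<lambda>u\<in>t. L u \<omega>)" using R_ev by auto
      next
        assume *: "terminal_tree X \<omega> = t \<and> R (\<lambda>u\<in>t. L u \<omega>)"
        then obtain f where f: "f \<in> B" "?ev f \<omega>" using elim by blast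
        then have "R f" using R_ev * by blast
        then show "\<exists>!f. f \<in> {f \<in> B. R f} \<and> ?ev f \<omega>" using f disj by blast
      qed
    qed
  qed (use finB ev_sets label_event_sets[OF t] in auto)
  also have "\<dots> = tree_prob p t / fact ?n * real (card {f \<in> B. R f})"
    using prob_ev by simp
  also have "{f \<in> B. R f} = {f \<in> leaves t \<rightarrow>\<^sub>E {1..?n}. bij_betw f (leaves t) {1..?n} \<and> R f}"
    by (auto simp: B_def)
  finally show ?thesis .
qed

lemma prob_induces_terminal_tree:
  assumes \<tau>: "leaf_labelled_tree \<tau> lab S" and t: "plane_tree t" and n: "card (leaves t) = n"
    and S: "S \<noteq> {}" "S \<subseteq> {1..n}"
  shows "\<P>(\<omega> in M. terminal_tree X \<omega> = t \<and> induces t (\<lambda>u. L u \<omega>) S \<tau> lab) =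
    tree_prob p t * real (card (strong_embeddings \<tau> t)) * fact (n - card S) / fact n"
proof -
  have leaf: "\<phi> u \<in> leaves t" if "\<phi> \<in> strong_embeddings \<tau> t" "u \<in> leaves \<tau>" for \<phi> u
    using strong_embedding_leaf[OF _ t that] \<tau> by (simp add: leaf_labelled_tree_def)
  have iff: "induces t f S \<tau> lab \<longleftrightarrow> (\<exists>\<phi>\<in>strong_embeddings \<tau> t. \<forall>u\<in>leaves \<tau>. f (\<phi> u) = lab u)"
    if "bij_betw f (leaves t) {1..n}" for f
    by (rule induces_iff_strong_embedding[OF \<tau> t _ S(1)]) (use that S(2) in \<open>auto simp: bij_betw_def\<close>)
  have "induces t f S \<tau> lab \<longleftrightarrow> induces t g S \<tau> lab"
    if eq: "\<And>u. u \<in> leaves t \<Longrightarrow> f u = g u" and f: "bij_betw f (leaves t) {1..n}" for f g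
  proof -
    have g: "bij_betw g (leaves t) {1..n}" using f bij_betw_cong[of "leaves t" f g] eq by blast
    show ?thesis unfolding iff[OF f] iff[OF g] using eq leaf by simp
  qed
  then have "\<P>(\<omega> in M. terminal_tree X \<omega> = t \<and> induces t (\<lambda>u\<in>t. L u \<omega>) S \<tau> lab) =
      tree_prob p t / fact n *
      real (card {f \<in> leaves t \<rightarrow>\<^sub>E {1..n}. bij_betw f (leaves t) {1..n} \<and> induces t f S \<tau> lab})"
    using prob_label_event[OF t, of "\<lambda>f. induces t f S \<tau> lab"] n by blast
  then show ?thesis
    unfolding card_inducing_labellings[OF \<tau> t n S] induces_restrict by simp
qed

lemma prob_induced_event:
  assumes p0: "pmf p 0 > 0" and p1: "pmf p 1 = 0" and \<tau>: "leaf_labelled_tree \<tau> lab S"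
    and S: "S \<noteq> {}" "S \<subseteq> {1..n}"
  shows "\<P>(\<omega> in M. induced_event X L n S \<tau> lab \<omega>) =
    tree_prob p \<tau> * fact (n - card S) / (pmf p 0 * fact n) *
    fps_nth (inverse ((1 - Phi1 p (reduced_gf p)) ^ card (tree_edges \<tau>)) * fps_deriv (reduced_gf p)) (n - card S)"
proof -
  have pl: "plane_tree \<tau>" and leaves: "card (leaves \<tau>) = card S"
    using \<tau> bij_betw_same_card by (auto simp: leaf_labelled_tree_def)
  have aS: "card S \<le> n" using card_mono[OF _ S(2)] by simp
  have "\<P>(\<omega> in M. induced_event X L n S \<tau> lab \<omega>) =
      (\<Sum>t\<in>reduced_trees n. \<P>(\<omega> in M. terminal_tree X \<omega> = t \<and> induces t (\<lambda>u. L u \<omega>) S \<tau> lab))"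
    unfolding induced_event_def
  proof (rule prob_has_leaves_conj[OF bp p1])
    fix t assume "plane_tree t"
    then show "{\<omega> \<in> space M. induces t (\<lambda>u. L u \<omega>) S \<tau> lab} \<in> sets M"
      unfolding induces_restrict
      using sets_finitely_many_labels[of L M t "\<lambda>g. induces t g S \<tau> lab"] plane_tree_finite L
      by (simp add: uniform_leaf_labelling_def)
  qed
  also have "\<dots> = (\<Sum>t\<in>reduced_trees n.
      tree_prob p t * real (card (strong_embeddings \<tau> t)) * fact (n - card S) / fact n)"
    by (intro sum.cong refl prob_induces_terminal_tree[OF \<tau> _ _ S]) (auto simp: reduced_trees_def)
  also have "\<dots> = fps_nth (embedding_gf p \<tau>) n * fact (n - card S) / fact n"
    by (simp add: embedding_gf_def tree_gf_def sum_distrib_right sum_divide_distrib)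
  finally show ?thesis
    using embedding_gf_nth[OF p0 p1 pl, of n] aS leaves by simp
qed

end

section \<open>The induced-tree formula\<close>

theorem lemma3p2:
  fixes p :: "nat pmf" and M :: "'w measure" and X :: "nat list \<Rightarrow> 'w \<Rightarrow> nat"
  assumes "pmf p 0 > 0" and "pmf p 1 = 0" and "(\<lambda>j. real j * pmf p j) sums 1"
    and "branching_process M p X"
  shows "(AE \<omega> in M. stops (\<lambda>u. X u \<omega>) \<and> plane_tree (terminal_tree X \<omega>)) \<and>
    (\<exists>!\<Phi>. leaf_gf p \<Phi>) \<and>
    (\<forall>\<Phi>. leaf_gf p \<Phi> \<longrightarrow>
      (\<forall>n. \<P>(\<omega> in M. has_leaves X n \<omega>) = fps_nth \<Phi> n) \<and>
      (\<forall>L n S \<tau> lab.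
        uniform_leaf_labelling M X L \<and> S \<noteq> {} \<and> S \<subseteq> {1..n} \<and> leaf_labelled_tree \<tau> lab S \<longrightarrow>
        \<P>(\<omega> in M. induced_event X L n S \<tau> lab \<omega> \<bar> has_leaves X n \<omega>)
          = \<P>(\<omega> in M. induced_event X L n S \<tau> lab \<omega>) / \<P>(\<omega> in M. has_leaves X n \<omega>) \<and>
        \<P>(\<omega> in M. induced_event X L n S \<tau> lab \<omega>)
          = tree_prob p \<tau> * fact (n - card S) / (pmf p 0 * fact n) *
            fps_nth (inverse ((1 - Phi1 p \<Phi>) ^ card (tree_edges \<tau>)) * fps_deriv \<Phi>) (n - card S)))"
proof (intro conjI allI impI)
  note p0 = assms(1) and p1 = assms(2) and bp = assms(4)
  have eq: "\<Phi> = reduced_gf p" if "leaf_gf p \<Phi>" for \<Phi>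
    using leaf_gf_unique[OF p1 that leaf_gf_reduced_gf[OF p1]] .
  show "AE \<omega> in M. stops (\<lambda>u. X u \<omega>) \<and> plane_tree (terminal_tree X \<omega>)"
    by (rule AE_stops[OF bp p1 assms(3)])
  show "\<exists>!\<Phi>. leaf_gf p \<Phi>" using leaf_gf_reduced_gf[OF p1] eq by blast
  show "\<P>(\<omega> in M. has_leaves X n \<omega>) = fps_nth \<Phi> n" if "leaf_gf p \<Phi>" for \<Phi> n
    using prob_has_leaves[OF bp p1] eq[OF that] by simp
  fix \<Phi> L n S \<tau> lab
  assume \<Phi>: "leaf_gf p \<Phi>" and *: "uniform_leaf_labelling M X L \<and> S \<noteq> {} \<and> S \<subseteq> {1..n} \<and> leaf_labelled_tree \<tau> lab S"
  have "induced_event X L n S \<tau> lab \<omega> \<and> has_leaves X n \<omega> \<longleftrightarrow> induced_event X L n S \<tau> lab \<omega>" for \<omega>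
    by (auto simp: induced_event_def)
  then show "\<P>(\<omega> in M. induced_event X L n S \<tau> lab \<omega> \<bar> has_leaves X n \<omega>)
      = \<P>(\<omega> in M. induced_event X L n S \<tau> lab \<omega>) / \<P>(\<omega> in M. has_leaves X n \<omega>)"
    by (simp add: cond_prob_def)
  show "\<P>(\<omega> in M. induced_event X L n S \<tau> lab \<omega>)
      = tree_prob p \<tau> * fact (n - card S) / (pmf p 0 * fact n) *
        fps_nth (inverse ((1 - Phi1 p \<Phi>) ^ card (tree_edges \<tau>)) * fps_deriv \<Phi>) (n - card S)"
    unfolding eq[OF \<Phi>] using prob_induced_event[OF bp _ p0 p1] * by blast
qed

end
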